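(* Let $\mathcal{K}$ be a Fraïssé class whose Fraïssé symmetry $(\mathbb{D}_\mathcal{K},G_\mathcal{K})$ is well-behaved. Let $\mathfrak{A},\mathfrak{B}\in\mathcal{K}$ have carriers $A,B$, and let $S\le\mathrm{Aut}(\mathfrak{A})$, $T\le\mathrm{Aut}(\mathfrak{B})$. Let $I$ be the set of pairs $(\rho,\mathfrak{C})$ where $\rho$ is a partial isomorphism between $\mathfrak{A}$ and $\mathfrak{B}$ and $\mathfrak{C}\in\mathcal{K}$ is a structure on the amalgamated sum $A\cup_\rho B$ such that the canonical maps $i:A\to A\cup_\rho B$ and $j:B\to A\cup_\rho B$ are embeddings $\mathfrak{A}\to\mathfrak{C}$ and $\mathfrak{B}\to\mathfrak{C}$. The group $S^{op}\times T$ acts on $I$ by $(\rho,\mathfrak{C})\cdot(\sigma,\tau)=(\rho',\mathfrak{C}')$, where $\rho'=\{(a,b):(\sigma(a),\tau^{-1}(b))\in\rho\}$ and $\mathfrak{C}'$ is the unique structure on $A\cup_{\rho'}B$ making the bijection $m:A\cup_\rho B\to A\cup_{\rho'}B$, $m(i(a))=i(\sigma^{-1}(a))$, $m(j(b))=j(\tau(b))$, an isomorphism $\mathfrak{C}\to\mathfrak{C}'$. Let $R\subseteq I$ contain exactly one representative of each orbit of this action, and for $(\rho,\mathfrak{C})\in R$ let $$S\Cup T=\{\theta\in\mathrm{Aut}(\mathfrak{C}):\exists\sigma\in S,\tau\in T.\ \theta\circ i=i\circ\sigma\text{ and }\theta\circ j=j\circ\tau\}.$$ Then there is an equivariant bijection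 $$[\![\mathfrak{A},S]\!]\times[\![\mathfrak{B},T]\!]\;\cong\;\coprod_{(\rho,\mathfrak{C})\in R}[\![\mathfrak{C},S\Cup T]\!].$$
   Context: Fix a finite relational signature; embeddings are injective maps preserving and reflecting all relations. A Fraïssé class $\mathcal{K}$ is a class of finite structures closed under isomorphism and substructures with amalgamation; its Fraïssé limit $\mathfrak{U}_\mathcal{K}$ is the countable homogeneous structure whose finite substructures are, up to isomorphism, exactly $\mathcal{K}$; $\mathbb{D}_\mathcal{K}$ is its carrier and $G_\mathcal{K}=\mathrm{Aut}(\mathfrak{U}_\mathcal{K})$, acting on products componentwise and on disjoint unions by cases. Well-behaved: every element of every nominal $G_\mathcal{K}$-set has a least finite support and every finite subset of $\mathbb{D}_\mathcal{K}$ is fungible (each of its elements is moved by some $\pi\in G_\mathcal{K}$ fixing the remaining elements). For $\mathfrak{A}\in\mathcal{K}$, $S\le\mathrm{Aut}(\mathfrak{A})$: $[\![\mathfrak{A},S]\!]$ is the set of embeddings $u:\mathfrak{A}\to\mathfrak{U}_\mathcal{K}$ modulo $u\equiv_S v\iff v=u\circ\sigma$ for some $\sigma\in S$, with action $[u]\cdot\pi=[\pi\circ u]$. A partial isomorphism between $\mathfrak{A}$ and $\mathfrak{B}$ is a relation $\rho\subseteq A\times B$ that is the graph of an isomorphism between an induced substructure of $\mathfrak{A}$ and an induced substructure of $\mathfrak{B}$. The amalgamated sum $A\cup_\rho B$ is the disjoint union of $A$ and $B$ with $a$ and $b$ identified whenever $(a,b)\in\rho$; $i,j$ are the canonical injections.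 *)

theory Defs
  imports "HOL-Algebra.Group_Action" "HOL-Library.Countable_Set"
begin

section \<open>Relational structures\<close>

text \<open>A relational signature is a partial map sending each of its symbols to its arity.  A finite
  signature is one with finite domain; it may be empty.\<close>

type_synonym 'r signature = "'r \<rightharpoonup> nat"

record ('a, 'r) rel_struct = "'a partial_object" +
  interp :: "'r \<Rightarrow> 'a list set"

text \<open>Symbols outside the signature are interpreted by the empty relation, so that two structures
  are equal in HOL iff they have the same carrier and the same relations.\<close>

definition rel_structure :: "'r signature \<Rightarrow> ('a, 'r) rel_struct \<Rightarrow> bool" where
  "rel_structure \<Sigma> M \<longleftrightarrow>
     (\<forall>r xs. xs \<in> interp M r \<longrightarrow> set xs \<subseteq> carrier M \<and> \<Sigma> r = Some (length xs))"

text \<open>As in \<^theory>\<open>HOL-Algebra.Bij\<close>, maps between carriers are taken extensional, so that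
  they are determined by their values on the carrier.\<close>

definition embeddings :: "('a, 'r) rel_struct \<Rightarrow> ('b, 'r) rel_struct \<Rightarrow> ('a \<Rightarrow> 'b) set" where
  "embeddings M N =
     {f \<in> carrier M \<rightarrow>\<^sub>E carrier N. inj_on f (carrier M) \<and>
        (\<forall>r xs. set xs \<subseteq> carrier M \<longrightarrow> (xs \<in> interp M r \<longleftrightarrow> map f xs \<in> interp N r))}"

definition isos :: "('a, 'r) rel_struct \<Rightarrow> ('b, 'r) rel_struct \<Rightarrow> ('a \<Rightarrow> 'b) set" where
  "isos M N = {f \<in> embeddings M N. f ` carrier M = carrier N}"

definition induced :: "('a, 'r) rel_struct \<Rightarrow> 'a set \<Rightarrow> ('a, 'r) rel_struct" where
  "induced M X = \<lparr>carrier = X, interp = \<lambda>r. {xs \<in> interp M r. set xs \<subseteq> X}\<rparr>"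

definition aut_group :: "('a, 'r) rel_struct \<Rightarrow> ('a \<Rightarrow> 'a) monoid" where
  "aut_group M = (BijGroup (carrier M))\<lparr>carrier := isos M M\<rparr>"

lemma carrier_aut_group [simp]: "carrier (aut_group M) = isos M M"
  by (simp add: aut_group_def)

lemma isos_self_Bij: "isos M M \<subseteq> Bij (carrier M)"
  by (auto simp: isos_def embeddings_def Bij_def bij_betw_def PiE_def)

lemma mult_aut_group [simp]:
  "f \<in> isos M M \<Longrightarrow> g \<in> isos M M \<Longrightarrow> f \<otimes>\<^bsub>aut_group M\<^esub> g = compose (carrier M) f g"
  using isos_self_Bij[of M] by (auto simp: aut_group_def BijGroup_def)

lemma one_aut_group [simp]: "\<one>\<^bsub>aut_group M\<^esub> = (\<lambda>x\<in>carrier M. x)"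
  by (simp add: aut_group_def BijGroup_def)

lemma compose_embeddings:
  assumes "f \<in> embeddings M N" "g \<in> embeddings N P"
  shows "compose (carrier M) g f \<in> embeddings M P"
proof -
  have f: "f \<in> carrier M \<rightarrow> carrier N" and g: "g \<in> carrier N \<rightarrow> carrier P"
    using assms by (auto simp: embeddings_def)
  have "map (compose (carrier M) g f) xs = map g (map f xs)" if "set xs \<subseteq> carrier M" for xs
    using that by (auto simp: compose_def)
  moreover have "set (map f xs) \<subseteq> carrier N" if "set xs \<subseteq> carrier M" for xs
    using that f by auto
  moreover have "inj_on (compose (carrier M) g f) (carrier M)"
    using assms f by (auto simp: embeddings_def inj_on_def compose_def Pi_iff)
  moreover have "compose (carrier M) g f \<in> carrier M \<rightarrow>\<^sub>E carrier P"
    using f g by (auto simp: compose_def)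
  moreover have "xs \<in> interp M r \<longleftrightarrow> map g (map f xs) \<in> interp P r"
    if "set xs \<subseteq> carrier M" for r xs
    using assms that \<open>set xs \<subseteq> carrier M \<Longrightarrow> set (map f xs) \<subseteq> carrier N\<close>
    by (simp add: embeddings_def del: map_map)
  ultimately show ?thesis
    unfolding embeddings_def by (simp del: map_map)
qed

lemma compose_isos:
  assumes "f \<in> isos M N" "g \<in> isos N P"
  shows "compose (carrier M) g f \<in> isos M P"
proof -
  have "compose (carrier M) g f ` carrier M = g ` f ` carrier M"
    by (auto simp: compose_def image_iff)
  then show ?thesis using assms compose_embeddings[of f M N g P] by (auto simp: isos_def)
qed

lemma inv_isos:
  assumes "f \<in> isos M N"
  shows "(\<lambda>y\<in>carrier N. inv_into (carrier M) f y) \<in> isos N M"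
proof -
  let ?g = "\<lambda>y\<in>carrier N. inv_into (carrier M) f y"
  have bij: "bij_betw f (carrier M) (carrier N)"
    using assms by (auto simp: isos_def embeddings_def bij_betw_def)
  then have bij': "bij_betw ?g (carrier N) (carrier M)"
    by (simp add: bij_betw_inv_into)
  have "xs \<in> interp N r \<longleftrightarrow> map ?g xs \<in> interp M r" if xs: "set xs \<subseteq> carrier N" for r xs
  proof -
    have "set (map ?g xs) \<subseteq> carrier M" using xs bij' by (auto simp: bij_betw_def)
    moreover have "map f (map ?g xs) = xs"
      using xs bij by (auto simp: bij_betw_def f_inv_into_f intro!: map_idI)
    moreover have "ys \<in> interp M r \<longleftrightarrow> map f ys \<in> interp N r" if "set ys \<subseteq> carrier M" for ys
      using assms that by (auto simp: isos_def embeddings_def)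
    ultimately show ?thesis by metis
  qed
  then show ?thesis
    using bij' by (auto simp: isos_def embeddings_def bij_betw_def)
qed

lemma group_aut_group: "group (aut_group M)"
proof -
  have "subgroup (isos M M) (BijGroup (carrier M))"
  proof (rule group.subgroupI[OF group_BijGroup])
    show "isos M M \<subseteq> carrier (BijGroup (carrier M))"
      using isos_self_Bij[of M] by (simp add: BijGroup_def)
    have "(\<lambda>x\<in>carrier M. x) \<in> isos M M"
    proof -
      have "map (\<lambda>x\<in>carrier M. x) xs = xs" if "set xs \<subseteq> carrier M" for xs
        using that by (auto intro!: map_idI)
      then show ?thesis by (auto simp: isos_def embeddings_def inj_on_def)
    qed
    then show "isos M M \<noteq> {}" by blast
  next
    fix f assume f: "f \<in> isos M M"
    then have "f \<in> Bij (carrier M)" using isos_self_Bij by blast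
    then show "inv\<^bsub>BijGroup (carrier M)\<^esub> f \<in> isos M M"
      using inv_isos[OF f] by (simp add: inv_BijGroup)
  next
    fix f g assume "f \<in> isos M M" "g \<in> isos M M"
    then show "f \<otimes>\<^bsub>BijGroup (carrier M)\<^esub> g \<in> isos M M"
      using compose_isos[of g M M f M] isos_self_Bij[of M] by (auto simp: BijGroup_def)
  qed
  then show ?thesis
    unfolding aut_group_def by (rule subgroup.subgroup_is_group[OF _ group_BijGroup])
qed


section \<open>Fraisse classes and their limits\<close>

text \<open>A class of finite structures closed under isomorphism is determined by its members whose
  carrier is a set of natural numbers, and is represented by the set \<open>K\<close> of these;
  \<open>in_class\<close> expresses membership for a structure on an arbitrary type.\<close>

definition in_class :: "'r signature \<Rightarrow> (nat, 'r) rel_struct set \<Rightarrow> ('a, 'r) rel_struct \<Rightarrow> bool" where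
  "in_class \<Sigma> K M \<longleftrightarrow> rel_structure \<Sigma> M \<and> (\<exists>N\<in>K. isos M N \<noteq> {})"

definition fraisse_class :: "'r signature \<Rightarrow> (nat, 'r) rel_struct set \<Rightarrow> bool" where
  "fraisse_class \<Sigma> K \<longleftrightarrow>
     (\<forall>M\<in>K. rel_structure \<Sigma> M \<and> finite (carrier M)) \<and>
     (\<forall>M\<in>K. \<forall>N. rel_structure \<Sigma> N \<and> isos M N \<noteq> {} \<longrightarrow> N \<in> K) \<and>
     (\<forall>M\<in>K. \<forall>X. X \<subseteq> carrier M \<longrightarrow> induced M X \<in> K) \<and>
     (\<forall>M\<in>K. \<forall>N1\<in>K. \<forall>N2\<in>K. \<forall>f1\<in>embeddings M N1. \<forall>f2\<in>embeddings M N2.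
        \<exists>P\<in>K. \<exists>g1\<in>embeddings N1 P. \<exists>g2\<in>embeddings N2 P.
          compose (carrier M) g1 f1 = compose (carrier M) g2 f2)"

definition homogeneous :: "('d, 'r) rel_struct \<Rightarrow> bool" where
  "homogeneous U \<longleftrightarrow>
     (\<forall>X Y f. finite X \<and> X \<subseteq> carrier U \<and> finite Y \<and> Y \<subseteq> carrier U \<and>
        f \<in> isos (induced U X) (induced U Y) \<longrightarrow>
        (\<exists>\<pi>\<in>carrier (aut_group U). \<forall>x\<in>X. \<pi> x = f x))"

definition fraisse_limit ::
    "'r signature \<Rightarrow> (nat, 'r) rel_struct set \<Rightarrow> ('d, 'r) rel_struct \<Rightarrow> bool" where
  "fraisse_limit \<Sigma> K U \<longleftrightarrow>
     rel_structure \<Sigma> U \<and> countable (carrier U) \<and> homogeneous U \<and>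
     (\<forall>X. finite X \<and> X \<subseteq> carrier U \<longrightarrow> in_class \<Sigma> K (induced U X)) \<and>
     (\<forall>M\<in>K. \<exists>X. finite X \<and> X \<subseteq> carrier U \<and> isos M (induced U X) \<noteq> {})"


section \<open>Nominal sets and well-behaved symmetries\<close>

text \<open>Multiplication in \<open>aut_group U\<close> is composition of functions, for which the action
  $[u] \cdot \pi = [\pi \circ u]$ is a left action in the sense of \<^locale>\<open>group_action\<close>.  The
  right actions of the opposite (diagrammatic) multiplication are the same thing.\<close>

definition supports ::
    "('d, 'r) rel_struct \<Rightarrow> (('d \<Rightarrow> 'd) \<Rightarrow> 'x \<Rightarrow> 'x) \<Rightarrow> 'd set \<Rightarrow> 'x \<Rightarrow> bool" where
  "supports U \<phi> F x \<longleftrightarrow>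
     F \<subseteq> carrier U \<and> (\<forall>\<pi>\<in>carrier (aut_group U). (\<forall>d\<in>F. \<pi> d = d) \<longrightarrow> \<phi> \<pi> x = x)"

definition nominal_set ::
    "('d, 'r) rel_struct \<Rightarrow> 'x set \<Rightarrow> (('d \<Rightarrow> 'd) \<Rightarrow> 'x \<Rightarrow> 'x) \<Rightarrow> bool" where
  "nominal_set U X \<phi> \<longleftrightarrow>
     group_action (aut_group U) X \<phi> \<and> (\<forall>x\<in>X. \<exists>F. finite F \<and> supports U \<phi> F x)"

definition has_least_support ::
    "('d, 'r) rel_struct \<Rightarrow> (('d \<Rightarrow> 'd) \<Rightarrow> 'x \<Rightarrow> 'x) \<Rightarrow> 'x \<Rightarrow> bool" where
  "has_least_support U \<phi> x \<longleftrightarrow>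
     (\<exists>F. finite F \<and> supports U \<phi> F x \<and> (\<forall>F'. finite F' \<and> supports U \<phi> F' x \<longrightarrow> F \<subseteq> F'))"

definition fungible :: "('d, 'r) rel_struct \<Rightarrow> 'd set \<Rightarrow> bool" where
  "fungible U F \<longleftrightarrow>
     (\<forall>c\<in>F. \<exists>\<pi>\<in>carrier (aut_group U). \<pi> c \<noteq> c \<and> (\<forall>d\<in>F - {c}. \<pi> d = d))"

text \<open>HOL cannot quantify over nominal sets of all types.  Every orbit is isomorphic to a set of
  cosets of a subgroup, so it is enough to quantify over the nominal sets whose elements are sets
  of maps; see \<open>well_behaved_has_least_support\<close> below.\<close>

definition well_behaved :: "('d, 'r) rel_struct \<Rightarrow> bool" where
  "well_behaved U \<longleftrightarrow>
     (\<forall>(X :: ('d \<Rightarrow> 'd) set set) \<phi>. nominal_set U X \<phi> \<longrightarrow> (\<forall>x\<in>X. has_least_support U \<phi> x)) \<and>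
     (\<forall>F. finite F \<and> F \<subseteq> carrier U \<longrightarrow> fungible U F)"

lemma group_actionI:
  assumes G: "group G"
    and ext: "\<And>g. g \<in> carrier G \<Longrightarrow> \<phi> g \<in> extensional E"
    and closed: "\<And>g x. g \<in> carrier G \<Longrightarrow> x \<in> E \<Longrightarrow> \<phi> g x \<in> E"
    and one: "\<And>x. x \<in> E \<Longrightarrow> \<phi> \<one>\<^bsub>G\<^esub> x = x"
    and mult: "\<And>g h x. g \<in> carrier G \<Longrightarrow> h \<in> carrier G \<Longrightarrow> x \<in> E \<Longrightarrow>
                 \<phi> (g \<otimes>\<^bsub>G\<^esub> h) x = \<phi> g (\<phi> h x)"
  shows "group_action G E \<phi>"
proof -
  interpret group G by (rule G)
  have Bij: "\<phi> g \<in> Bij E" if g: "g \<in> carrier G" for g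
  proof -
    have "bij_betw (\<phi> g) E E"
    proof (rule bij_betw_byWitness[where f' = "\<phi> (inv\<^bsub>G\<^esub> g)"])
      show "\<forall>x\<in>E. \<phi> (inv\<^bsub>G\<^esub> g) (\<phi> g x) = x" "\<forall>x\<in>E. \<phi> g (\<phi> (inv\<^bsub>G\<^esub> g) x) = x"
        using g one mult[of "inv\<^bsub>G\<^esub> g" g] mult[of g "inv\<^bsub>G\<^esub> g"] by auto
    qed (use g closed in auto)
    then show ?thesis using ext[OF g] by (simp add: Bij_def)
  qed
  have "\<phi> (g \<otimes>\<^bsub>G\<^esub> h) = compose E (\<phi> g) (\<phi> h)" if "g \<in> carrier G" "h \<in> carrier G" for g h
    using that ext[of "g \<otimes>\<^bsub>G\<^esub> h"] mult by (auto simp: compose_def extensional_def fun_eq_iff)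
  then have "\<phi> \<in> hom G (BijGroup E)" using Bij by (auto simp: hom_def BijGroup_def)
  then show ?thesis
    by (simp add: group_action_def group_hom_def group_hom_axioms_def group_BijGroup)
qed

lemma well_behaved_has_least_support:
  fixes X :: "'x set"
  assumes wb: "well_behaved U" and nom: "nominal_set U X \<phi>" and x: "x \<in> X"
  shows "has_least_support U \<phi> x"
proof -
  interpret group_action "aut_group U" X \<phi> using nom by (simp add: nominal_set_def)
  let ?G = "aut_group U"
  define Orb where "Orb = orbit ?G \<phi> x"
  define c where "c y = {\<pi> \<in> carrier ?G. \<phi> \<pi> x = y}" for y
  define d where "d = inv_into Orb c"
  define Y where "Y = c ` Orb"
  define \<psi> where "\<psi> g = (\<lambda>C\<in>Y. c (\<phi> g (d C)))" for g
  have G: "group ?G" by (rule group_aut_group)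
  have one: "\<phi> \<one>\<^bsub>?G\<^esub> y = y" if "y \<in> X" for y
    using that id_eq_one by (metis restrict_apply')
  have OrbX: "Orb \<subseteq> X" using x element_image by (auto simp: Orb_def orbit_def)
  have act: "\<phi> g y \<in> Orb" if "g \<in> carrier ?G" "y \<in> Orb" for g y
  proof -
    obtain h where h: "h \<in> carrier ?G" "y = \<phi> h x" using \<open>y \<in> Orb\<close> by (auto simp: Orb_def orbit_def)
    then have "\<phi> g y = \<phi> (g \<otimes>\<^bsub>?G\<^esub> h) x" using composition_rule[OF x] that by simp
    then show ?thesis using h that G unfolding Orb_def orbit_def
      by (metis (mono_tags, lifting) group.is_monoid mem_Collect_eq monoid.m_closed)
  qed
  have inj: "inj_on c Orb"
    by (auto simp: inj_on_def c_def Orb_def orbit_def)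
  have dc: "d (c y) = y" if "y \<in> Orb" for y using that inj by (simp add: d_def)
  have \<psi>c: "\<psi> g (c y) = c (\<phi> g y)" if "y \<in> Orb" for g y
    using that dc by (simp add: \<psi>_def Y_def)
  have ga: "group_action ?G Y \<psi>"
  proof (rule group_actionI[OF G])
    fix g h C assume g: "g \<in> carrier ?G" "h \<in> carrier ?G" and "C \<in> Y"
    then obtain y where y: "y \<in> Orb" "C = c y" by (auto simp: Y_def)
    then have "\<phi> (g \<otimes>\<^bsub>?G\<^esub> h) y = \<phi> g (\<phi> h y)" using composition_rule[of y g h] OrbX g by blast
    then show "\<psi> (g \<otimes>\<^bsub>?G\<^esub> h) C = \<psi> g (\<psi> h C)"
      using y g act \<psi>c by simp
  next
    fix g C assume g: "g \<in> carrier ?G" and "C \<in> Y"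
    then obtain y where "y \<in> Orb" "C = c y" by (auto simp: Y_def)
    then show "\<psi> g C \<in> Y" using act[of g y] \<psi>c[of y g] g by (simp add: Y_def)
  next
    fix g show "\<psi> g \<in> extensional Y" by (simp add: \<psi>_def)
  next
    fix C assume "C \<in> Y"
    then obtain y where y: "y \<in> Orb" "C = c y" by (auto simp: Y_def)
    then have "\<phi> \<one>\<^bsub>?G\<^esub> y = y" using one[of y] OrbX by blast
    then show "\<psi> \<one>\<^bsub>?G\<^esub> C = C"
      using y \<psi>c[of y "\<one>\<^bsub>?G\<^esub>"] by simp
  qed
  have sup: "supports U \<psi> F (c y) \<longleftrightarrow> supports U \<phi> F y" if "y \<in> Orb" for F y
    using that act[OF _ that] \<psi>c[OF that] inj_on_eq_iff[OF inj _ that]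
    unfolding supports_def by (metis (no_types, lifting))
  have "nominal_set U Y \<psi>"
    unfolding nominal_set_def
  proof (intro conjI ga ballI)
    fix C assume "C \<in> Y"
    then obtain y where y: "y \<in> Orb" "C = c y" by (auto simp: Y_def)
    then obtain F where "finite F" "supports U \<phi> F y"
      using nom OrbX unfolding nominal_set_def by blast
    then show "\<exists>F. finite F \<and> supports U \<psi> F C" using sup y by blast
  qed
  moreover have "x \<in> Orb"
    using one[OF x] G unfolding Orb_def orbit_def
    by (metis (mono_tags, lifting) group.is_monoid mem_Collect_eq monoid.one_closed)
  moreover from this have "c x \<in> Y" by (simp add: Y_def)
  ultimately have "has_least_support U \<psi> (c x)" using wb by (auto simp: well_behaved_def)
  then show ?thesis using sup[OF \<open>x \<in> Orb\<close>] by (simp add: has_least_support_def)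
qed

definition equivariant_bij ::
    "('g, 'm) monoid_scheme \<Rightarrow> 'x set \<Rightarrow> ('g \<Rightarrow> 'x \<Rightarrow> 'x) \<Rightarrow> 'y set \<Rightarrow> ('g \<Rightarrow> 'y \<Rightarrow> 'y) \<Rightarrow>
     ('x \<Rightarrow> 'y) \<Rightarrow> bool" where
  "equivariant_bij G X \<phi> Y \<psi> f \<longleftrightarrow>
     bij_betw f X Y \<and> (\<forall>g\<in>carrier G. \<forall>x\<in>X. f (\<phi> g x) = \<psi> g (f x))"

definition prod_act :: "('g \<Rightarrow> 'x \<Rightarrow> 'x) \<Rightarrow> ('g \<Rightarrow> 'y \<Rightarrow> 'y) \<Rightarrow> 'g \<Rightarrow> 'x \<times> 'y \<Rightarrow> 'x \<times> 'y" where
  "prod_act \<phi> \<psi> g = (\<lambda>(x, y). (\<phi> g x, \<psi> g y))"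

definition coprod_act :: "('i \<Rightarrow> 'g \<Rightarrow> 'x \<Rightarrow> 'x) \<Rightarrow> 'g \<Rightarrow> 'i \<times> 'x \<Rightarrow> 'i \<times> 'x" where
  "coprod_act \<phi> g = (\<lambda>(i, x). (i, \<phi> i g x))"


section \<open>Embeddings modulo a group of automorphisms\<close>

definition emb_rel ::
    "('d, 'r) rel_struct \<Rightarrow> ('a, 'r) rel_struct \<Rightarrow> ('a \<Rightarrow> 'a) set \<Rightarrow> (('a \<Rightarrow> 'd) \<times> ('a \<Rightarrow> 'd)) set" where
  "emb_rel U \<AA> S =
     {(u, v). u \<in> embeddings \<AA> U \<and> v \<in> embeddings \<AA> U \<and> (\<exists>\<sigma>\<in>S. v = compose (carrier \<AA>) u \<sigma>)}"

definition emb_quot ::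
    "('d, 'r) rel_struct \<Rightarrow> ('a, 'r) rel_struct \<Rightarrow> ('a \<Rightarrow> 'a) set \<Rightarrow> ('a \<Rightarrow> 'd) set set" where
  "emb_quot U \<AA> S = embeddings \<AA> U // emb_rel U \<AA> S"

definition emb_act ::
    "('d, 'r) rel_struct \<Rightarrow> ('a, 'r) rel_struct \<Rightarrow> ('a \<Rightarrow> 'a) set \<Rightarrow>
     ('d \<Rightarrow> 'd) \<Rightarrow> ('a \<Rightarrow> 'd) set \<Rightarrow> ('a \<Rightarrow> 'd) set" where
  "emb_act U \<AA> S \<pi> = (\<lambda>c\<in>emb_quot U \<AA> S. (\<lambda>u. compose (carrier \<AA>) \<pi> u) ` c)"

lemma emb_act_class:
  assumes "\<pi> \<in> carrier (aut_group U)" "u \<in> embeddings \<AA> U" "subgroup S (aut_group \<AA>)"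
  shows "emb_act U \<AA> S \<pi> (emb_rel U \<AA> S `` {u}) = emb_rel U \<AA> S `` {compose (carrier \<AA>) \<pi> u}"
proof -
  have S: "\<sigma> \<in> embeddings \<AA> \<AA>" if "\<sigma> \<in> S" for \<sigma>
    using subgroup.subset[OF assms(3)] that by (auto simp: isos_def)
  have \<pi>: "\<pi> \<in> embeddings U U" using assms(1) by (auto simp: isos_def)
  have assoc: "compose (carrier \<AA>) \<pi> (compose (carrier \<AA>) u \<sigma>) =
      compose (carrier \<AA>) (compose (carrier \<AA>) \<pi> u) \<sigma>" if "\<sigma> \<in> S" for \<sigma>
    using S[OF that] by (auto simp: compose_def embeddings_def fun_eq_iff)
  have cls: "emb_rel U \<AA> S `` {v} = compose (carrier \<AA>) v ` S" if v: "v \<in> embeddings \<AA> U" for v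
    using v compose_embeddings[OF S v] by (auto simp: emb_rel_def)
  have "emb_rel U \<AA> S `` {u} \<in> emb_quot U \<AA> S"
    using assms(2) by (simp add: emb_quot_def quotientI)
  then have "emb_act U \<AA> S \<pi> (emb_rel U \<AA> S `` {u}) =
      compose (carrier \<AA>) \<pi> ` compose (carrier \<AA>) u ` S"
    by (simp add: emb_act_def cls[OF assms(2)])
  also have "\<dots> = compose (carrier \<AA>) (compose (carrier \<AA>) \<pi> u) ` S"
    unfolding image_image using assoc by (rule image_cong[OF refl])
  finally show ?thesis
    using cls[OF compose_embeddings[OF assms(2) \<pi>]] by simp
qed


section \<open>Amalgamated sums\<close>

definition partial_iso :: "('a, 'r) rel_struct \<Rightarrow> ('b, 'r) rel_struct \<Rightarrow> ('a \<times> 'b) set \<Rightarrow> bool" where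
  "partial_iso \<AA> \<BB> \<rho> \<longleftrightarrow>
     (\<exists>X Y. X \<subseteq> carrier \<AA> \<and> Y \<subseteq> carrier \<BB> \<and>
        (\<exists>f\<in>isos (induced \<AA> X) (induced \<BB> Y). \<rho> = {(x, f x) | x. x \<in> X}))"

text \<open>For a partial isomorphism \<open>\<rho>\<close> the following relation is already transitive (see
  \<open>equiv_amalg_rel\<close>), hence it is the equivalence relation on the disjoint union generated by
  \<open>\<rho>\<close>.\<close>

definition amalg_rel :: "'a set \<Rightarrow> 'b set \<Rightarrow> ('a \<times> 'b) set \<Rightarrow> (('a + 'b) \<times> ('a + 'b)) set" where
  "amalg_rel A B \<rho> = Id_on (A <+> B) \<union>
     {(Inl a, Inr b) | a b. (a, b) \<in> \<rho>} \<union> {(Inr b, Inl a) | a b. (a, b) \<in> \<rho>}"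

definition amalg_sum :: "'a set \<Rightarrow> 'b set \<Rightarrow> ('a \<times> 'b) set \<Rightarrow> ('a + 'b) set set" where
  "amalg_sum A B \<rho> = (A <+> B) // amalg_rel A B \<rho>"

definition amalg_inl :: "'a set \<Rightarrow> 'b set \<Rightarrow> ('a \<times> 'b) set \<Rightarrow> 'a \<Rightarrow> ('a + 'b) set" where
  "amalg_inl A B \<rho> = (\<lambda>a\<in>A. amalg_rel A B \<rho> `` {Inl a})"

definition amalg_inr :: "'a set \<Rightarrow> 'b set \<Rightarrow> ('a \<times> 'b) set \<Rightarrow> 'b \<Rightarrow> ('a + 'b) set" where
  "amalg_inr A B \<rho> = (\<lambda>b\<in>B. amalg_rel A B \<rho> `` {Inr b})"

lemma equiv_amalg_rel:
  assumes "partial_iso \<AA> \<BB> \<rho>"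
  shows "equiv (carrier \<AA> <+> carrier \<BB>) (amalg_rel (carrier \<AA>) (carrier \<BB>) \<rho>)"
proof -
  obtain X Y f where *: "X \<subseteq> carrier \<AA>" "Y \<subseteq> carrier \<BB>"
    "f \<in> isos (induced \<AA> X) (induced \<BB> Y)" "\<rho> = {(x, f x) | x. x \<in> X}"
    using assms by (auto simp: partial_iso_def)
  then have f: "inj_on f X" "f ` X = Y" by (auto simp: isos_def embeddings_def induced_def)
  then have "\<rho> \<subseteq> carrier \<AA> \<times> carrier \<BB>" using * by auto
  then show ?thesis using f(1) unfolding *(4)
    by (auto simp: equiv_def refl_on_def sym_def trans_def amalg_rel_def inj_on_def)
qed

definition amalg_index ::
    "'r signature \<Rightarrow> (nat, 'r) rel_struct set \<Rightarrow> ('a, 'r) rel_struct \<Rightarrow> ('b, 'r) rel_struct \<Rightarrow>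
     (('a \<times> 'b) set \<times> (('a + 'b) set, 'r) rel_struct) set" where
  "amalg_index \<Sigma> K \<AA> \<BB> =
     {(\<rho>, \<CC>). partial_iso \<AA> \<BB> \<rho> \<and> in_class \<Sigma> K \<CC> \<and>
        carrier \<CC> = amalg_sum (carrier \<AA>) (carrier \<BB>) \<rho> \<and>
        amalg_inl (carrier \<AA>) (carrier \<BB>) \<rho> \<in> embeddings \<AA> \<CC> \<and>
        amalg_inr (carrier \<AA>) (carrier \<BB>) \<rho> \<in> embeddings \<BB> \<CC>}"


section \<open>The action on amalgamated sums\<close>

definition moved_rel ::
    "'a set \<Rightarrow> 'b set \<Rightarrow> ('a \<Rightarrow> 'a) \<Rightarrow> ('b \<Rightarrow> 'b) \<Rightarrow> ('a \<times> 'b) set \<Rightarrow> ('a \<times> 'b) set" where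
  "moved_rel A B \<sigma> \<tau> \<rho> = {(a, b) \<in> A \<times> B. (\<sigma> a, inv_into B \<tau> b) \<in> \<rho>}"

text \<open>The map $m$ of the amalgamated sum of \<open>\<rho>\<close> onto that of \<open>moved_rel A B \<sigma> \<tau> \<rho>\<close>,
  given elementwise on classes; its defining equations are \<open>amalg_map_inl\<close> and
  \<open>amalg_map_inr\<close>.\<close>

definition amalg_map ::
    "'a set \<Rightarrow> 'b set \<Rightarrow> ('a \<Rightarrow> 'a) \<Rightarrow> ('b \<Rightarrow> 'b) \<Rightarrow> ('a \<times> 'b) set \<Rightarrow>
     ('a + 'b) set \<Rightarrow> ('a + 'b) set" where
  "amalg_map A B \<sigma> \<tau> \<rho> = (\<lambda>c\<in>amalg_sum A B \<rho>. map_sum (inv_into A \<sigma>) \<tau> ` c)"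

definition image_struct :: "('x \<Rightarrow> 'y) \<Rightarrow> ('x, 'r) rel_struct \<Rightarrow> ('y, 'r) rel_struct" where
  "image_struct m M = \<lparr>carrier = m ` carrier M, interp = \<lambda>r. map m ` interp M r\<rparr>"

text \<open>By \<open>image_struct_unique\<close> below, the second component is the unique structure making
  $m$ an isomorphism.  With composition as multiplication, \<open>amalg_act\<close> is a left action of
  $S^{op} \times T$ on \<open>amalg_index\<close>.\<close>

definition amalg_act ::
    "('a, 'r) rel_struct \<Rightarrow> ('b, 'r) rel_struct \<Rightarrow> ('a \<Rightarrow> 'a) \<times> ('b \<Rightarrow> 'b) \<Rightarrow>
     ('a \<times> 'b) set \<times> (('a + 'b) set, 'r) rel_struct \<Rightarrow>
     ('a \<times> 'b) set \<times> (('a + 'b) set, 'r) rel_struct" where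
  "amalg_act \<AA> \<BB> = (\<lambda>(\<sigma>, \<tau>) (\<rho>, \<CC>).
     (moved_rel (carrier \<AA>) (carrier \<BB>) \<sigma> \<tau> \<rho>,
      image_struct (amalg_map (carrier \<AA>) (carrier \<BB>) \<sigma> \<tau> \<rho>) \<CC>))"

lemma image_struct_unique:
  assumes M: "rel_structure \<Sigma> M" and m: "inj_on m (carrier M)" "m \<in> extensional (carrier M)"
  shows "rel_structure \<Sigma> N \<and> m \<in> isos M N \<longleftrightarrow> N = image_struct m M"
proof
  assume "N = image_struct m M"
  moreover have "xs \<in> interp M r \<longleftrightarrow> map m xs \<in> map m ` interp M r" if "set xs \<subseteq> carrier M" for r xs
  proof
    assume "map m xs \<in> map m ` interp M r"
    then obtain ys where ys: "ys \<in> interp M r" "map m xs = map m ys" by auto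
    then have "set ys \<subseteq> carrier M" using M by (auto simp: rel_structure_def)
    then have "xs = ys" using ys(2) m(1) that by (metis inj_on_map_eq_map inj_on_subset le_sup_iff)
    then show "xs \<in> interp M r" using ys by simp
  qed auto
  ultimately show "rel_structure \<Sigma> N \<and> m \<in> isos M N"
    using M m by (fastforce simp: rel_structure_def image_struct_def isos_def embeddings_def PiE_def)
next
  assume N: "rel_structure \<Sigma> N \<and> m \<in> isos M N"
  then have c: "m ` carrier M = carrier N" by (auto simp: isos_def)
  have *: "xs \<in> interp M r \<longleftrightarrow> map m xs \<in> interp N r" if "set xs \<subseteq> carrier M" for r xs
    using N that by (auto simp: isos_def embeddings_def)
  have "interp N r = map m ` interp M r" for r
  proof (intro equalityI subsetI)
    fix ys assume ys: "ys \<in> interp N r"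
    then have "set ys \<subseteq> m ` carrier M" using N c by (auto simp: rel_structure_def)
    then have "ys \<in> map m ` lists (carrier M)" by (metis in_listsI lists_image subsetD)
    then show "ys \<in> map m ` interp M r" using * ys by auto
  next
    fix ys assume "ys \<in> map m ` interp M r"
    then obtain xs where "xs \<in> interp M r" "ys = map m xs" by auto
    moreover from this have "set xs \<subseteq> carrier M" using M by (auto simp: rel_structure_def)
    ultimately show "ys \<in> interp N r" using * by blast
  qed
  then have "interp N = (\<lambda>r. map m ` interp M r)" by blast
  then show "N = image_struct m M" using c by (cases N) (simp add: image_struct_def)
qed

lemma amalg_map_class:
  assumes \<sigma>: "bij_betw \<sigma> A A" and \<tau>: "bij_betw \<tau> B B" and \<rho>: "\<rho> \<subseteq> A \<times> B" and z: "z \<in> A <+> B"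
  shows "map_sum (inv_into A \<sigma>) \<tau> ` (amalg_rel A B \<rho> `` {z}) =
    amalg_rel A B (moved_rel A B \<sigma> \<tau> \<rho>) `` {map_sum (inv_into A \<sigma>) \<tau> z}"
proof -
  have \<sigma>': "inv_into A \<sigma> a \<in> A" "\<sigma> (inv_into A \<sigma> a) = a" "inv_into A \<sigma> (\<sigma> a) = a" "\<sigma> a \<in> A"
    if "a \<in> A" for a
    using that \<sigma> by (auto simp: bij_betw_def inv_into_into f_inv_into_f)
  have \<tau>': "inv_into B \<tau> b \<in> B" "\<tau> (inv_into B \<tau> b) = b" "inv_into B \<tau> (\<tau> b) = b" "\<tau> b \<in> B"
    if "b \<in> B" for b
    using that \<tau> by (auto simp: bij_betw_def inv_into_into f_inv_into_f)
  show ?thesis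
  proof (cases z)
    case (Inl a)
    then have "a \<in> A" using z by auto
    have l: "amalg_rel A B \<rho>' `` {Inl a'} = insert (Inl a') (Inr ` {b. (a', b) \<in> \<rho>'})"
      if "a' \<in> A" for \<rho>' a' using that by (auto simp: amalg_rel_def)
    have "\<tau> ` {b. (a, b) \<in> \<rho>} = {b. (inv_into A \<sigma> a, b) \<in> moved_rel A B \<sigma> \<tau> \<rho>}"
      using \<sigma>'[OF \<open>a \<in> A\<close>] \<tau>' \<rho> by (force simp: moved_rel_def image_iff)
    then show ?thesis using Inl \<open>a \<in> A\<close> \<sigma>'(1) by (simp add: l image_image[symmetric] image_comp)
  next
    case (Inr b)
    then have "b \<in> B" using z by auto
    have l: "amalg_rel A B \<rho>' `` {Inr b'} = insert (Inr b') (Inl ` {a. (a, b') \<in> \<rho>'})"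
      if "b' \<in> B" for \<rho>' b' using that by (auto simp: amalg_rel_def)
    have "inv_into A \<sigma> ` {a. (a, b) \<in> \<rho>} = {a. (a, \<tau> b) \<in> moved_rel A B \<sigma> \<tau> \<rho>}"
      using \<tau>'[OF \<open>b \<in> B\<close>] \<sigma>' \<rho> by (force simp: moved_rel_def image_iff)
    then show ?thesis using Inr \<open>b \<in> B\<close> \<tau>'(4) by (simp add: l image_image[symmetric] image_comp)
  qed
qed

lemma amalg_map_inl:
  assumes "bij_betw \<sigma> A A" "bij_betw \<tau> B B" "\<rho> \<subseteq> A \<times> B" "a \<in> A"
  shows "amalg_map A B \<sigma> \<tau> \<rho> (amalg_inl A B \<rho> a) =
    amalg_inl A B (moved_rel A B \<sigma> \<tau> \<rho>) (inv_into A \<sigma> a)"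
proof -
  have "inv_into A \<sigma> a \<in> A" using assms by (metis bij_betw_def inv_into_into)
  then show ?thesis using assms amalg_map_class[OF assms(1-3), of "Inl a"]
    by (auto simp: amalg_map_def amalg_inl_def amalg_sum_def quotient_def)
qed

lemma amalg_map_inr:
  assumes "bij_betw \<sigma> A A" "bij_betw \<tau> B B" "\<rho> \<subseteq> A \<times> B" "b \<in> B"
  shows "amalg_map A B \<sigma> \<tau> \<rho> (amalg_inr A B \<rho> b) =
    amalg_inr A B (moved_rel A B \<sigma> \<tau> \<rho>) (\<tau> b)"
proof -
  have "\<tau> b \<in> B" using assms by (metis bij_betwE)
  then show ?thesis using assms amalg_map_class[OF assms(1-3), of "Inr b"]
    by (auto simp: amalg_map_def amalg_inr_def amalg_sum_def quotient_def)
qed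

lemma bij_betw_amalg_map:
  assumes "bij_betw \<sigma> A A" "bij_betw \<tau> B B" "\<rho> \<subseteq> A \<times> B"
  shows "bij_betw (amalg_map A B \<sigma> \<tau> \<rho>) (amalg_sum A B \<rho>) (amalg_sum A B (moved_rel A B \<sigma> \<tau> \<rho>))"
proof -
  let ?s = "map_sum (inv_into A \<sigma>) \<tau>"
  have i: "bij_betw (inv_into A \<sigma>) A A" using assms(1) by (rule bij_betw_inv_into)
  have "?s ` (A <+> B) = inv_into A \<sigma> ` A <+> \<tau> ` B"
    unfolding Plus_def image_Un image_image by simp
  then have s: "?s ` (A <+> B) = A <+> B"
    using i assms(2) by (simp add: bij_betw_def)
  have inj: "inj_on ?s (A <+> B)"
    using inj_onD[OF bij_betw_imp_inj_on[OF i]] inj_onD[OF bij_betw_imp_inj_on[OF assms(2)]]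
    by (intro inj_onI) (elim PlusE; simp)
  have "amalg_sum A B \<rho> \<subseteq> Pow (A <+> B)"
    using assms(3) by (auto simp: amalg_sum_def quotient_def amalg_rel_def)
  then have "inj_on ((`) ?s) (amalg_sum A B \<rho>)"
    using inj by (meson inj_on_image_Pow inj_on_subset)
  moreover have "(`) ?s ` amalg_sum A B \<rho> = amalg_sum A B (moved_rel A B \<sigma> \<tau> \<rho>)"
  proof -
    have "(`) ?s ` amalg_sum A B \<rho> =
        (\<lambda>z. amalg_rel A B (moved_rel A B \<sigma> \<tau> \<rho>) `` {?s z}) ` (A <+> B)"
      using amalg_map_class[OF assms]
      by (simp add: amalg_sum_def quotient_def UNION_singleton_eq_range image_image)
    also have "\<dots> = (\<lambda>z. amalg_rel A B (moved_rel A B \<sigma> \<tau> \<rho>) `` {z}) ` ?s ` (A <+> B)"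
      by (simp add: image_image)
    finally show ?thesis
      by (simp add: s amalg_sum_def quotient_def UNION_singleton_eq_range)
  qed
  ultimately show ?thesis by (simp add: bij_betw_def amalg_map_def inj_on_def)
qed

definition op_group :: "'g monoid \<Rightarrow> 'g monoid" where
  "op_group G = G\<lparr>mult := \<lambda>x y. y \<otimes>\<^bsub>G\<^esub> x\<rparr>"

definition glued_auts ::
    "('a, 'r) rel_struct \<Rightarrow> ('b, 'r) rel_struct \<Rightarrow> ('a \<Rightarrow> 'a) set \<Rightarrow> ('b \<Rightarrow> 'b) set \<Rightarrow>
     ('a \<times> 'b) set \<Rightarrow> (('a + 'b) set, 'r) rel_struct \<Rightarrow> (('a + 'b) set \<Rightarrow> ('a + 'b) set) set" where
  "glued_auts \<AA> \<BB> S T \<rho> \<CC> =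
     (let A = carrier \<AA>; B = carrier \<BB>; i = amalg_inl A B \<rho>; j = amalg_inr A B \<rho> in
      {\<theta> \<in> carrier (aut_group \<CC>). \<exists>\<sigma>\<in>S. \<exists>\<tau>\<in>T.
         compose A \<theta> i = compose A i \<sigma> \<and> compose B \<theta> j = compose B j \<tau>})"

end

(* The bijection is built from right to left: the class of w : C -> U in the summand of (rho, C)
   goes to the pair of classes of w o i and w o j.  It is onto because a pair (u, v) of embeddings
   glues to an injection of the amalgamated sum over rho = {(a, b). u a = v b}, along which the
   structure of U is pulled back; replacing (rho, C) by its representative changes (u, v) only by
   an element of S x T.  It is injective because if w and w' induce equivalent pairs, say by sigma
   and tau, then the map m of the action of (sigma, tau) satisfies w' o m = w; so the two summands
   are indexed by the same orbit, hence by the same representative, and m belongs to the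
   glued group. *)

theory Submission
  imports Defs
begin

section \<open>Embeddings\<close>

text \<open>A tuple in \<open>M\<close> and its image under \<open>h\<close> satisfy the same
  relations, and \<open>g\<close> takes the image under \<open>m\<close> to the image under
  \<open>h\<close>, so \<open>g\<close> reflects these relations back to \<open>N\<close>. The
  canonical injections, \<open>amalg_map\<close> and the partial isomorphisms are all handled
  through this factorisation.\<close>

lemma embeddings_factor:
  assumes g: "g \<in> embeddings N P" and h: "h \<in> embeddings M P"
    and m: "m \<in> carrier M \<rightarrow>\<^sub>E carrier N" and gm: "\<And>x. x \<in> carrier M \<Longrightarrow> g (m x) = h x"
  shows "m \<in> embeddings M N"
proof -
  have "inj_on m (carrier M)"
  proof (rule inj_onI)
    fix x y assume "x \<in> carrier M" "y \<in> carrier M" "m x = m y"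
    moreover from this have "h x = h y" using gm by metis
    ultimately show "x = y" using h by (auto simp: embeddings_def dest: inj_onD)
  qed
  moreover have "xs \<in> interp M r \<longleftrightarrow> map m xs \<in> interp N r" if xs: "set xs \<subseteq> carrier M" for r xs
  proof -
    have "xs \<in> interp M r \<longleftrightarrow> map h xs \<in> interp P r"
      using h xs by (simp add: embeddings_def)
    also have "map h xs = map g (map m xs)" using xs gm by auto
    also have "map g (map m xs) \<in> interp P r \<longleftrightarrow> map m xs \<in> interp N r"
    proof -
      have "set (map m xs) \<subseteq> carrier N" using xs m by auto
      then show ?thesis using g unfolding embeddings_def by blast
    qed
    finally show ?thesis .
  qed
  ultimately show ?thesis using m by (simp add: embeddings_def)
qed

lemma isos_factor:
  assumes "g \<in> embeddings N P" "h \<in> embeddings M P" "m \<in> extensional (carrier M)"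
    and "m ` carrier M = carrier N" and "\<And>x. x \<in> carrier M \<Longrightarrow> g (m x) = h x"
  shows "m \<in> isos M N"
proof -
  have "m \<in> carrier M \<rightarrow>\<^sub>E carrier N" using assms(3,4) by (auto simp: PiE_def)
  from embeddings_factor[OF assms(1,2) this assms(5)] have "m \<in> embeddings M N" .
  then show ?thesis using assms(4) by (simp add: isos_def)
qed

section \<open>Induced substructures and structures pulled back along injections\<close>

lemma restrict_embeddings_induced:
  assumes "f \<in> embeddings M N" "X \<subseteq> carrier M"
  shows "restrict f X \<in> embeddings (induced M X) N"
proof -
  have "inj_on (restrict f X) X"
    using assms by (auto simp: embeddings_def inj_on_restrict_eq intro: inj_on_subset)
  moreover have "restrict f X \<in> X \<rightarrow>\<^sub>E carrier N"
    using assms by (auto simp: embeddings_def)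
  moreover have "xs \<in> interp M r \<longleftrightarrow> map (restrict f X) xs \<in> interp N r" if "set xs \<subseteq> X" for r xs
  proof -
    have "map (restrict f X) xs = map f xs" using that by auto
    moreover have "xs \<in> interp M r \<longleftrightarrow> map f xs \<in> interp N r"
      using assms that by (auto simp: embeddings_def)
    ultimately show ?thesis by metis
  qed
  ultimately show ?thesis by (simp add: embeddings_def induced_def)
qed

text \<open>An extensional \<open>f\<close> may happen to take a value in \<open>M\<close> outside
  \<open>X\<close> as well, so only the bound on \<open>set xs\<close> keeps the relations inside
  the carrier.\<close>

definition pullback_struct :: "('x \<Rightarrow> 'y) \<Rightarrow> 'x set \<Rightarrow> ('y, 'r) rel_struct \<Rightarrow> ('x, 'r) rel_struct" where
  "pullback_struct f X M = \<lparr>carrier = X, interp = \<lambda>r. {xs. set xs \<subseteq> X \<and> map f xs \<in> interp M r}\<rparr>"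

lemma carrier_pullback_struct [simp]: "carrier (pullback_struct f X M) = X"
  by (simp add: pullback_struct_def)

lemma embeddings_pullback_struct:
  assumes "f \<in> X \<rightarrow>\<^sub>E carrier M" "inj_on f X"
  shows "f \<in> embeddings (pullback_struct f X M) M"
  using assms by (simp add: embeddings_def pullback_struct_def)

text \<open>\<open>f\<close> is an isomorphism onto the substructure of \<open>U\<close> induced on
  the image of \<open>f\<close>, and every finite induced substructure of the limit belongs to the
  class.\<close>

lemma in_class_pullback_struct:
  assumes U: "fraisse_limit \<Sigma> K U" and f: "f \<in> X \<rightarrow>\<^sub>E carrier U" "inj_on f X"
    and X: "finite X"
  shows "in_class \<Sigma> K (pullback_struct f X U)"
proof -
  let ?M = "pullback_struct f X U"
  have fX: "f ` X \<subseteq> carrier U" using f by auto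
  have "rel_structure \<Sigma> U" using U by (simp add: fraisse_limit_def)
  then have "rel_structure \<Sigma> ?M"
    unfolding rel_structure_def pullback_struct_def by fastforce
  moreover obtain N k where "N \<in> K" and k: "k \<in> isos (induced U (f ` X)) N"
    using U fX X unfolding fraisse_limit_def in_class_def by (metis all_not_in_conv finite_imageI)
  moreover have "f \<in> isos ?M (induced U (f ` X))"
  proof (rule isos_factor)
    \<comment> \<open>The restricted identity is the inclusion of the image in \<open>U\<close>.
      After \<open>f\<close> it gives \<open>f\<close> again, which is the triangle that
      \<open>isos_factor\<close> asks for.\<close>
    have "(\<lambda>x\<in>carrier U. x) \<in> embeddings U U"
      using group.is_monoid[OF group_aut_group[of U], THEN monoid.one_closed] by (simp add: isos_def)
    from restrict_embeddings_induced[OF this fX]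
    show "restrict (\<lambda>x\<in>carrier U. x) (f ` X) \<in> embeddings (induced U (f ` X)) U" .
    show "f \<in> embeddings ?M U" using f by (rule embeddings_pullback_struct)
  qed (use f fX in \<open>auto simp: induced_def PiE_def\<close>)
  ultimately show ?thesis
    unfolding in_class_def using compose_isos[of f ?M _ k N] by blast
qed

section \<open>Groups of automorphisms and quotients of embeddings\<close>

lemma subgroup_aut_group_isos:
  "subgroup S (aut_group M) \<Longrightarrow> \<sigma> \<in> S \<Longrightarrow> \<sigma> \<in> isos M M"
  using subgroup.subset by fastforce

lemma isos_bij_betw: "f \<in> isos M N \<Longrightarrow> bij_betw f (carrier M) (carrier N)"
  by (auto simp: isos_def embeddings_def bij_betw_def)

lemma subgroup_aut_group_one:
  "subgroup S (aut_group M) \<Longrightarrow> (\<lambda>x\<in>carrier M. x) \<in> S"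
  using subgroup.one_closed by fastforce

lemma subgroup_aut_group_compose:
  "subgroup S (aut_group M) \<Longrightarrow> \<sigma> \<in> S \<Longrightarrow> \<tau> \<in> S \<Longrightarrow> compose (carrier M) \<sigma> \<tau> \<in> S"
  using subgroup.m_closed[of S "aut_group M" \<sigma> \<tau>] by (simp add: subgroup_aut_group_isos)

lemma subgroup_aut_group_inverse:
  assumes "subgroup S (aut_group M)" "\<sigma> \<in> S"
  obtains \<sigma>' where "\<sigma>' \<in> S" "\<And>x. x \<in> carrier M \<Longrightarrow> \<sigma> (\<sigma>' x) = x"
    "\<And>x. x \<in> carrier M \<Longrightarrow> \<sigma>' (\<sigma> x) = x"
proof
  interpret group "aut_group M" by (rule group_aut_group)
  let ?i = "inv\<^bsub>aut_group M\<^esub> \<sigma>"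
  have \<sigma>: "\<sigma> \<in> isos M M" using assms by (rule subgroup_aut_group_isos)
  show S: "?i \<in> S" using assms by (rule subgroup.m_inv_closed)
  have i: "?i \<in> isos M M" using assms(1) S by (rule subgroup_aut_group_isos)
  have "compose (carrier M) \<sigma> ?i = (\<lambda>x\<in>carrier M. x)" "compose (carrier M) ?i \<sigma> = (\<lambda>x\<in>carrier M. x)"
    using r_inv[of \<sigma>] l_inv[of \<sigma>] \<sigma> i by simp_all
  then show "\<sigma> (?i x) = x" "?i (\<sigma> x) = x" if "x \<in> carrier M" for x
    using that by (metis compose_eq restrict_apply')+
qed

text \<open>Embeddings and composites are extensional, so the defining equation can be tested
  pointwise on the carrier, the form in which later arguments produce and consume it.\<close>

lemma emb_rel_iff:
  assumes "subgroup S (aut_group M)"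
  shows "(u, v) \<in> emb_rel U M S \<longleftrightarrow>
    u \<in> embeddings M U \<and> v \<in> embeddings M U \<and> (\<exists>\<sigma>\<in>S. \<forall>x\<in>carrier M. v x = u (\<sigma> x))"
proof -
  have "v = compose (carrier M) u \<sigma> \<longleftrightarrow> (\<forall>x\<in>carrier M. v x = u (\<sigma> x))"
    if "v \<in> embeddings M U" for \<sigma>
    using that by (auto simp: embeddings_def PiE_def compose_def fun_eq_iff extensional_def)
  then show ?thesis unfolding emb_rel_def by blast
qed

section \<open>Classes of embeddings and maps between quotients\<close>

lemma equiv_emb_rel:
  assumes S: "subgroup S (aut_group M)"
  shows "equiv (embeddings M U) (emb_rel U M S)"
proof (rule equivI)
  show "emb_rel U M S \<subseteq> embeddings M U \<times> embeddings M U" by (auto simp: emb_rel_def)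
  show "refl_on (embeddings M U) (emb_rel U M S)"
    by (auto simp: refl_on_def emb_rel_iff[OF S] intro!: bexI[OF _ subgroup_aut_group_one[OF S]])
  show "sym (emb_rel U M S)"
  proof (rule symI)
    fix u v assume "(u, v) \<in> emb_rel U M S"
    then obtain \<sigma> where uv: "u \<in> embeddings M U" "v \<in> embeddings M U" and \<sigma>: "\<sigma> \<in> S"
      and v: "\<And>x. x \<in> carrier M \<Longrightarrow> v x = u (\<sigma> x)"
      by (auto simp: emb_rel_iff[OF S])
    obtain \<sigma>' where "\<sigma>' \<in> S" and \<sigma>': "\<And>x. x \<in> carrier M \<Longrightarrow> \<sigma> (\<sigma>' x) = x"
      using subgroup_aut_group_inverse[OF S \<sigma>] by blast
    moreover have "\<sigma>' x \<in> carrier M" if "x \<in> carrier M" for x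
      using isos_bij_betw[OF subgroup_aut_group_isos[OF S \<open>\<sigma>' \<in> S\<close>]] that by (rule bij_betwE[rule_format])
    ultimately show "(v, u) \<in> emb_rel U M S"
      using uv v by (auto simp: emb_rel_iff[OF S] intro!: bexI[of _ \<sigma>'])
  qed
  show "trans (emb_rel U M S)"
  proof (rule transI)
    fix u v w assume "(u, v) \<in> emb_rel U M S" "(v, w) \<in> emb_rel U M S"
    then obtain \<sigma> \<tau> where e: "u \<in> embeddings M U" "w \<in> embeddings M U" and st: "\<sigma> \<in> S" "\<tau> \<in> S"
      and "\<And>x. x \<in> carrier M \<Longrightarrow> v x = u (\<sigma> x)" "\<And>x. x \<in> carrier M \<Longrightarrow> w x = v (\<tau> x)"
      by (auto simp: emb_rel_iff[OF S])
    moreover have "\<tau> x \<in> carrier M" if "x \<in> carrier M" for x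
      using isos_bij_betw[OF subgroup_aut_group_isos[OF S \<open>\<tau> \<in> S\<close>]] that by (rule bij_betwE[rule_format])
    ultimately have "\<forall>x\<in>carrier M. w x = u (compose (carrier M) \<sigma> \<tau> x)"
      by (simp add: compose_eq)
    then show "(u, w) \<in> emb_rel U M S"
      using e subgroup_aut_group_compose[OF S st] emb_rel_iff[OF S] by blast
  qed
qed

lemma emb_quot_cases:
  assumes "c \<in> emb_quot U M S"
  obtains u where "u \<in> embeddings M U" "c = emb_rel U M S `` {u}"
  using assms by (auto simp: emb_quot_def elim: quotientE)

lemma emb_act_closed:
  assumes S: "subgroup S (aut_group M)" and \<pi>: "\<pi> \<in> carrier (aut_group U)" and c: "c \<in> emb_quot U M S"
  shows "emb_act U M S \<pi> c \<in> emb_quot U M S"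
proof -
  obtain u where u: "u \<in> embeddings M U" "c = emb_rel U M S `` {u}"
    using c by (rule emb_quot_cases)
  have "compose (carrier M) \<pi> u \<in> embeddings M U"
    using u(1) \<pi> compose_embeddings by (fastforce simp: isos_def)
  then show ?thesis
    using u emb_act_class[OF \<pi> u(1) S] by (simp add: emb_quot_def quotientI)
qed

text \<open>A map on representatives descends to quotients by taking the image of a whole class and
  saturating it. When that image lies in one class, the saturation is that class.\<close>

lemma equiv_Image_eq_class:
  assumes "equiv E r" "y \<in> Y" "Y \<subseteq> r `` {y}"
  shows "r `` Y = r `` {y}"
proof
  have "trans r" using assms(1) by (rule equivE)
  then show "r `` Y \<subseteq> r `` {y}" using assms(3) by (blast dest: transD)
qed (use assms(2) in blast)

text \<open>The natural map runs from the coproduct to the product, opposite to the direction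
  wanted. Closure of \<open>Y\<close> under the action ensures that \<open>inv_into\<close> cancels
  \<open>f\<close> at the moved point.\<close>

lemma equivariant_bij_inv_into:
  assumes "equivariant_bij G Y \<psi> X \<phi> f" and "\<And>g y. g \<in> carrier G \<Longrightarrow> y \<in> Y \<Longrightarrow> \<psi> g y \<in> Y"
  shows "equivariant_bij G X \<phi> Y \<psi> (inv_into Y f)"
proof -
  have f: "bij_betw f Y X" "\<And>g y. g \<in> carrier G \<Longrightarrow> y \<in> Y \<Longrightarrow> f (\<psi> g y) = \<phi> g (f y)"
    using assms(1) by (auto simp: equivariant_bij_def)
  have "inv_into Y f (\<phi> g x) = \<psi> g (inv_into Y f x)" if "g \<in> carrier G" "x \<in> X" for g x
  proof -
    obtain y where "y \<in> Y" "x = f y" using f(1) \<open>x \<in> X\<close> by (auto simp: bij_betw_def)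
    then show ?thesis using f assms(2) that by (metis bij_betw_def inv_into_f_f)
  qed
  then show ?thesis using f(1) by (simp add: equivariant_bij_def bij_betw_inv_into)
qed

section \<open>Pairs of embeddings and amalgamated sums\<close>

lemma partial_iso_subset: "partial_iso \<AA> \<BB> \<rho> \<Longrightarrow> \<rho> \<subseteq> carrier \<AA> \<times> carrier \<BB>"
  by (auto simp: partial_iso_def isos_def embeddings_def induced_def)

text \<open>Each class has a representative in one of the two summands. Claims about points of the
  sum thereby reduce to the two injections.\<close>

lemma amalg_sum_eq: "amalg_sum A B \<rho> = amalg_inl A B \<rho> ` A \<union> amalg_inr A B \<rho> ` B"
  by (force simp: amalg_sum_def quotient_def amalg_inl_def amalg_inr_def)

lemma amalg_inl_extensional: "amalg_inl A B \<rho> \<in> extensional A"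
  by (simp add: amalg_inl_def)

lemma amalg_inr_extensional: "amalg_inr A B \<rho> \<in> extensional B"
  by (simp add: amalg_inr_def)

text \<open>Classes agree exactly when their representatives are related, and a left and a right
  point are related only through \<rho>. So \<rho> can be recovered from the two injections.\<close>

lemma amalg_inl_eq_inr_iff:
  assumes "partial_iso \<AA> \<BB> \<rho>" "a \<in> carrier \<AA>" "b \<in> carrier \<BB>"
  shows "amalg_inl (carrier \<AA>) (carrier \<BB>) \<rho> a = amalg_inr (carrier \<AA>) (carrier \<BB>) \<rho> b \<longleftrightarrow> (a, b) \<in> \<rho>"
proof -
  have "Inl a \<in> carrier \<AA> <+> carrier \<BB>" "Inr b \<in> carrier \<AA> <+> carrier \<BB>" using assms by auto
  from eq_equiv_class_iff[OF equiv_amalg_rel[OF assms(1)] this] show ?thesis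
    using assms(2,3) by (simp add: amalg_inl_def amalg_inr_def) (auto simp: amalg_rel_def)
qed

lemma amalg_indexD:
  assumes "(\<rho>, \<CC>) \<in> amalg_index \<Sigma> K \<AA> \<BB>"
  shows "partial_iso \<AA> \<BB> \<rho>" "rel_structure \<Sigma> \<CC>"
    "carrier \<CC> = amalg_sum (carrier \<AA>) (carrier \<BB>) \<rho>"
    "amalg_inl (carrier \<AA>) (carrier \<BB>) \<rho> \<in> embeddings \<AA> \<CC>"
    "amalg_inr (carrier \<AA>) (carrier \<BB>) \<rho> \<in> embeddings \<BB> \<CC>"
  using assms by (auto simp: amalg_index_def in_class_def)

section \<open>The glued automorphism group\<close>

lemma compose_eq_compose_iff: "compose X f g = compose X h k \<longleftrightarrow> (\<forall>x\<in>X. f (g x) = h (k x))"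
  by (auto simp: compose_def fun_eq_iff)

lemma mem_glued_auts_iff:
  "\<theta> \<in> glued_auts \<AA> \<BB> S T \<rho> \<CC> \<longleftrightarrow> \<theta> \<in> isos \<CC> \<CC> \<and>
     (\<exists>\<sigma>\<in>S. \<exists>\<tau>\<in>T.
        (\<forall>a\<in>carrier \<AA>. \<theta> (amalg_inl (carrier \<AA>) (carrier \<BB>) \<rho> a) = amalg_inl (carrier \<AA>) (carrier \<BB>) \<rho> (\<sigma> a)) \<and>
        (\<forall>b\<in>carrier \<BB>. \<theta> (amalg_inr (carrier \<AA>) (carrier \<BB>) \<rho> b) = amalg_inr (carrier \<AA>) (carrier \<BB>) \<rho> (\<tau> b)))"
  by (simp add: glued_auts_def Let_def compose_eq_compose_iff)

text \<open>Units, inverses and products of the witnesses in \<open>S\<close> and \<open>T\<close>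
  witness the unit, inverses and products of the glued automorphisms. This is what makes
  \<open>emb_rel\<close> on embeddings of \<CC> an equivalence.\<close>

lemma subgroup_glued_auts:
  assumes S: "subgroup S (aut_group \<AA>)" and T: "subgroup T (aut_group \<BB>)"
    and p: "(\<rho>, \<CC>) \<in> amalg_index \<Sigma> K \<AA> \<BB>"
  shows "subgroup (glued_auts \<AA> \<BB> S T \<rho> \<CC>) (aut_group \<CC>)"
proof -
  interpret group "aut_group \<CC>" by (rule group_aut_group)
  let ?i = "amalg_inl (carrier \<AA>) (carrier \<BB>) \<rho>" and ?j = "amalg_inr (carrier \<AA>) (carrier \<BB>) \<rho>"
  have C: "carrier \<CC> = ?i ` carrier \<AA> \<union> ?j ` carrier \<BB>"
    using amalg_indexD(3)[OF p] by (simp add: amalg_sum_eq)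
  have clS: "\<sigma> a \<in> carrier \<AA>" if "\<sigma> \<in> S" "a \<in> carrier \<AA>" for \<sigma> a
    using isos_bij_betw[OF subgroup_aut_group_isos[OF S]] that bij_betwE by blast
  have clT: "\<tau> b \<in> carrier \<BB>" if "\<tau> \<in> T" "b \<in> carrier \<BB>" for \<tau> b
    using isos_bij_betw[OF subgroup_aut_group_isos[OF T]] that bij_betwE by blast
  show ?thesis
  proof (rule subgroupI)
    show "glued_auts \<AA> \<BB> S T \<rho> \<CC> \<subseteq> carrier (aut_group \<CC>)"
      by (auto simp: mem_glued_auts_iff)
    have "\<one>\<^bsub>aut_group \<CC>\<^esub> \<in> glued_auts \<AA> \<BB> S T \<rho> \<CC>"
      unfolding mem_glued_auts_iff using one_closed C
      by (auto intro!: bexI[OF _ subgroup_aut_group_one[OF S]] bexI[OF _ subgroup_aut_group_one[OF T]])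
    then show "glued_auts \<AA> \<BB> S T \<rho> \<CC> \<noteq> {}" by blast
  next
    fix \<theta> assume "\<theta> \<in> glued_auts \<AA> \<BB> S T \<rho> \<CC>"
    then obtain \<sigma> \<tau> where \<theta>: "\<theta> \<in> isos \<CC> \<CC>" and st: "\<sigma> \<in> S" "\<tau> \<in> T"
      and i: "\<And>a. a \<in> carrier \<AA> \<Longrightarrow> \<theta> (?i a) = ?i (\<sigma> a)"
      and j: "\<And>b. b \<in> carrier \<BB> \<Longrightarrow> \<theta> (?j b) = ?j (\<tau> b)"
      by (auto simp: mem_glued_auts_iff)
    obtain \<sigma>' where \<sigma>': "\<sigma>' \<in> S" "\<And>a. a \<in> carrier \<AA> \<Longrightarrow> \<sigma> (\<sigma>' a) = a"
      using subgroup_aut_group_inverse[OF S st(1)] by blast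
    obtain \<tau>' where \<tau>': "\<tau>' \<in> T" "\<And>b. b \<in> carrier \<BB> \<Longrightarrow> \<tau> (\<tau>' b) = b"
      using subgroup_aut_group_inverse[OF T st(2)] by blast
    let ?t = "inv\<^bsub>aut_group \<CC>\<^esub> \<theta>"
    have t: "?t \<in> isos \<CC> \<CC>" using inv_closed[of \<theta>] \<theta> by simp
    have "compose (carrier \<CC>) ?t \<theta> = (\<lambda>x\<in>carrier \<CC>. x)"
      using l_inv[of \<theta>] \<theta> t by simp
    then have inv: "?t (\<theta> x) = x" if "x \<in> carrier \<CC>" for x
      using that by (metis compose_eq restrict_apply')
    \<comment> \<open>Apply the inverse of \<theta> to the equation that \<theta> takes the left
      point of \<sigma>' a to the left point of \<sigma> (\<sigma>' a), that is, of a.\<close>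
    have "?t (?i a) = ?i (\<sigma>' a)" if "a \<in> carrier \<AA>" for a
      using inv[of "?i (\<sigma>' a)"] i[of "\<sigma>' a"] \<sigma>' clS[OF \<sigma>'(1) that] that C by auto
    moreover have "?t (?j b) = ?j (\<tau>' b)" if "b \<in> carrier \<BB>" for b
      using inv[of "?j (\<tau>' b)"] j[of "\<tau>' b"] \<tau>' clT[OF \<tau>'(1) that] that C by auto
    ultimately show "?t \<in> glued_auts \<AA> \<BB> S T \<rho> \<CC>"
      unfolding mem_glued_auts_iff using t \<sigma>'(1) \<tau>'(1) by blast
  next
    fix \<theta> \<theta>' assume "\<theta> \<in> glued_auts \<AA> \<BB> S T \<rho> \<CC>" "\<theta>' \<in> glued_auts \<AA> \<BB> S T \<rho> \<CC>"
    then obtain \<sigma> \<tau> \<sigma>' \<tau>' where \<theta>: "\<theta> \<in> isos \<CC> \<CC>" "\<theta>' \<in> isos \<CC> \<CC>"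
      and st: "\<sigma> \<in> S" "\<tau> \<in> T" "\<sigma>' \<in> S" "\<tau>' \<in> T"
      and i: "\<And>a. a \<in> carrier \<AA> \<Longrightarrow> \<theta> (?i a) = ?i (\<sigma> a)" "\<And>a. a \<in> carrier \<AA> \<Longrightarrow> \<theta>' (?i a) = ?i (\<sigma>' a)"
      and j: "\<And>b. b \<in> carrier \<BB> \<Longrightarrow> \<theta> (?j b) = ?j (\<tau> b)" "\<And>b. b \<in> carrier \<BB> \<Longrightarrow> \<theta>' (?j b) = ?j (\<tau>' b)"
      by (auto simp: mem_glued_auts_iff)
    have "\<theta> \<otimes>\<^bsub>aut_group \<CC>\<^esub> \<theta>' \<in> isos \<CC> \<CC>" using m_closed[of \<theta> \<theta>'] \<theta> by (simp del: mult_aut_group)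
    moreover have "\<forall>a\<in>carrier \<AA>. compose (carrier \<CC>) \<theta> \<theta>' (?i a) = ?i (compose (carrier \<AA>) \<sigma> \<sigma>' a)"
      using i clS[OF st(3)] C by (simp add: compose_def)
    moreover have "\<forall>b\<in>carrier \<BB>. compose (carrier \<CC>) \<theta> \<theta>' (?j b) = ?j (compose (carrier \<BB>) \<tau> \<tau>' b)"
      using j clT[OF st(4)] C by (simp add: compose_def)
    ultimately show "\<theta> \<otimes>\<^bsub>aut_group \<CC>\<^esub> \<theta>' \<in> glued_auts \<AA> \<BB> S T \<rho> \<CC>"
      unfolding mem_glued_auts_iff
      using \<theta> subgroup_aut_group_compose[OF S st(1,3)] subgroup_aut_group_compose[OF T st(2,4)] by auto
  qed
qed

text \<open>Embeddings in \<open>U\<close> separate the points of a sum, so the equations for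
  \<open>w\<close> and \<open>w'\<close> turn coincidences in one sum into coincidences in the
  other; hence \<rho>' is \<rho> moved by \<sigma> and \<tau>. They also make \<open>w'\<close>
  after \<open>amalg_map\<close> equal to \<open>w\<close>, so \<open>amalg_map\<close> is an
  isomorphism, and uniqueness of the transported structure identifies \<CC>'. That \<sigma> stands
  on the side of \<open>w\<close> and \<tau> on the side of \<open>w'\<close> reflects that
  \<open>amalg_map\<close> inverts \<sigma> but not \<tau>.\<close>

lemma amalg_act_eq:
  assumes p: "(\<rho>, \<CC>) \<in> amalg_index \<Sigma> K \<AA> \<BB>" and q: "(\<rho>', \<CC>') \<in> amalg_index \<Sigma> K \<AA> \<BB>"
    and \<sigma>: "bij_betw \<sigma> (carrier \<AA>) (carrier \<AA>)" and \<tau>: "bij_betw \<tau> (carrier \<BB>) (carrier \<BB>)"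
    and w: "w \<in> embeddings \<CC> U" and w': "w' \<in> embeddings \<CC>' U"
    and i: "\<And>a. a \<in> carrier \<AA> \<Longrightarrow> w' (amalg_inl (carrier \<AA>) (carrier \<BB>) \<rho>' a) =
      w (amalg_inl (carrier \<AA>) (carrier \<BB>) \<rho> (\<sigma> a))"
    and j: "\<And>b. b \<in> carrier \<BB> \<Longrightarrow> w' (amalg_inr (carrier \<AA>) (carrier \<BB>) \<rho>' (\<tau> b)) =
      w (amalg_inr (carrier \<AA>) (carrier \<BB>) \<rho> b)"
  shows "amalg_act \<AA> \<BB> (\<sigma>, \<tau>) (\<rho>, \<CC>) = (\<rho>', \<CC>')"
    and "amalg_map (carrier \<AA>) (carrier \<BB>) \<sigma> \<tau> \<rho> \<in> isos \<CC> \<CC>'"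
    and "\<And>z. z \<in> carrier \<CC> \<Longrightarrow> w' (amalg_map (carrier \<AA>) (carrier \<BB>) \<sigma> \<tau> \<rho> z) = w z"
proof -
  let ?A = "carrier \<AA>" and ?B = "carrier \<BB>"
  let ?m = "amalg_map ?A ?B \<sigma> \<tau> \<rho>"
  note P = amalg_indexD[OF p] and Q = amalg_indexD[OF q]
  have \<rho>: "\<rho> \<subseteq> ?A \<times> ?B" and \<rho>': "\<rho>' \<subseteq> ?A \<times> ?B"
    using P(1) Q(1) by (auto dest: partial_iso_subset)
  have winj: "inj_on w (carrier \<CC>)" "inj_on w' (carrier \<CC>')"
    using w w' by (auto simp: embeddings_def)
  have \<sigma>': "inv_into ?A \<sigma> a \<in> ?A" "\<sigma> (inv_into ?A \<sigma> a) = a" "\<sigma> a \<in> ?A" if "a \<in> ?A" for a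
    using that \<sigma> by (auto simp: bij_betw_def inv_into_into f_inv_into_f)
  have \<tau>': "inv_into ?B \<tau> b \<in> ?B" "\<tau> (inv_into ?B \<tau> b) = b" if "b \<in> ?B" for b
    using that \<tau> by (auto simp: bij_betw_def inv_into_into f_inv_into_f)
  have "(a, b) \<in> \<rho>' \<longleftrightarrow> (\<sigma> a, inv_into ?B \<tau> b) \<in> \<rho>" if ab: "a \<in> ?A" "b \<in> ?B" for a b
  proof -
    have c: "amalg_inl ?A ?B \<rho>' a \<in> carrier \<CC>'" "amalg_inr ?A ?B \<rho>' b \<in> carrier \<CC>'"
      "amalg_inl ?A ?B \<rho> (\<sigma> a) \<in> carrier \<CC>" "amalg_inr ?A ?B \<rho> (inv_into ?B \<tau> b) \<in> carrier \<CC>"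
      using ab \<sigma>' \<tau>' by (auto simp: P(3) Q(3) amalg_sum_eq)
    have "(a, b) \<in> \<rho>' \<longleftrightarrow> amalg_inl ?A ?B \<rho>' a = amalg_inr ?A ?B \<rho>' b"
      using amalg_inl_eq_inr_iff[OF Q(1) ab] by simp
    also have "\<dots> \<longleftrightarrow> w' (amalg_inl ?A ?B \<rho>' a) = w' (amalg_inr ?A ?B \<rho>' b)"
      using winj(2) c by (simp add: inj_on_eq_iff)
    also have "\<dots> \<longleftrightarrow> w (amalg_inl ?A ?B \<rho> (\<sigma> a)) = w (amalg_inr ?A ?B \<rho> (inv_into ?B \<tau> b))"
      using i[OF ab(1)] j[OF \<tau>'(1)[OF ab(2)]] \<tau>'(2)[OF ab(2)] by simp
    also have "\<dots> \<longleftrightarrow> amalg_inl ?A ?B \<rho> (\<sigma> a) = amalg_inr ?A ?B \<rho> (inv_into ?B \<tau> b)"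
      using winj(1) c by (simp add: inj_on_eq_iff)
    finally show ?thesis
      using amalg_inl_eq_inr_iff[OF P(1) \<sigma>'(3)[OF ab(1)] \<tau>'(1)[OF ab(2)]] by simp
  qed
  then have moved: "moved_rel ?A ?B \<sigma> \<tau> \<rho> = \<rho>'"
    using \<rho>' by (auto simp: moved_rel_def)
  \<comment> \<open>On a left point \<open>amalg_map\<close> applies the inverse of \<sigma>, which
    cancels the \<sigma> in the equation for the left injections.\<close>
  have wm: "w' (?m z) = w z" if "z \<in> carrier \<CC>" for z
    using that amalg_map_inl[OF \<sigma> \<tau> \<rho>] amalg_map_inr[OF \<sigma> \<tau> \<rho>] i j \<sigma>'
    by (auto simp: P(3) amalg_sum_eq moved)
  have m: "?m \<in> extensional (carrier \<CC>)" "?m ` carrier \<CC> = carrier \<CC>'" "inj_on ?m (carrier \<CC>)"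
    using bij_betw_amalg_map[OF \<sigma> \<tau> \<rho>] by (auto simp: moved bij_betw_def P(3) Q(3) amalg_map_def)
  show iso: "?m \<in> isos \<CC> \<CC>'" using isos_factor[OF w' w m(1,2) wm] .
  show "amalg_act \<AA> \<BB> (\<sigma>, \<tau>) (\<rho>, \<CC>) = (\<rho>', \<CC>')"
    using image_struct_unique[OF P(2) m(3,1), of \<CC>'] Q(2) iso by (simp add: amalg_act_def moved)
  show "w' (?m z) = w z" if "z \<in> carrier \<CC>" for z using that by (rule wm)
qed

text \<open>Where the image of \<open>u\<close> meets that of \<open>v\<close>, the inverse of
  \<open>v\<close> after \<open>u\<close> is a bijection \<open>f\<close> with \<open>v\<close>
  after \<open>f\<close> equal to \<open>u\<close>. Factoring one embedding through the other, it
  preserves and reflects the relations.\<close>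

lemma partial_iso_kernel:
  assumes u: "u \<in> embeddings \<AA> U" and v: "v \<in> embeddings \<BB> U"
  shows "partial_iso \<AA> \<BB> {(a, b) \<in> carrier \<AA> \<times> carrier \<BB>. u a = v b}"
proof -
  let ?A = "carrier \<AA>" and ?B = "carrier \<BB>"
  define X where "X = {a \<in> ?A. u a \<in> v ` ?B}"
  define Y where "Y = {b \<in> ?B. v b \<in> u ` ?A}"
  define f where "f = restrict (\<lambda>a. inv_into ?B v (u a)) X"
  have XY: "X \<subseteq> ?A" "Y \<subseteq> ?B" by (auto simp: X_def Y_def)
  have inj: "inj_on u ?A" "inj_on v ?B" using u v by (auto simp: embeddings_def)
  have f: "f a \<in> ?B" "v (f a) = u a" if "a \<in> X" for a
    using that by (auto simp: f_def X_def inv_into_into f_inv_into_f)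
  have f': "f a = b" if "a \<in> ?A" "b \<in> ?B" "u a = v b" for a b
    using that inj(2) by (auto simp: f_def X_def)
  have fX: "f ` X = Y"
  proof
    show "f ` X \<subseteq> Y" using f XY(1) by (auto simp: Y_def)
    show "Y \<subseteq> f ` X"
    proof
      fix b assume "b \<in> Y"
      then obtain a where "a \<in> ?A" "b \<in> ?B" "u a = v b" by (auto simp: Y_def)
      then show "b \<in> f ` X" using f'[of a b] by (intro image_eqI[of _ _ a]) (auto simp: X_def)
    qed
  qed
  have "f \<in> isos (induced \<AA> X) (induced \<BB> Y)"
  proof (rule isos_factor)
    show "restrict v Y \<in> embeddings (induced \<BB> Y) U" "restrict u X \<in> embeddings (induced \<AA> X) U"
      using u v XY by (auto intro: restrict_embeddings_induced)
    show "restrict v Y (f x) = restrict u X x" if "x \<in> carrier (induced \<AA> X)" for x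
      using that f(2) fX by (auto simp: induced_def)
  qed (use fX in \<open>simp_all add: induced_def f_def\<close>)
  moreover have "{(a, b) \<in> ?A \<times> ?B. u a = v b} = {(x, f x) | x. x \<in> X}"
    using f f' XY(1) by (auto simp: X_def)
  ultimately show ?thesis using XY unfolding partial_iso_def by blast
qed

text \<open>Identifying exactly the points with equal image makes the map induced by
  \<open>u\<close> and \<open>v\<close> on the sum injective. Pulling the structure of
  \<open>U\<close> back along it gives \<CC>, which is in the class because the sum is
  finite.\<close>

lemma amalg_index_of_embeddings:
  assumes U: "fraisse_limit \<Sigma> K U" and fin: "finite (carrier \<AA>)" "finite (carrier \<BB>)"
    and u: "u \<in> embeddings \<AA> U" and v: "v \<in> embeddings \<BB> U"
  obtains \<rho> \<CC> w where "(\<rho>, \<CC>) \<in> amalg_index \<Sigma> K \<AA> \<BB>" "w \<in> embeddings \<CC> U"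
    "\<And>a. a \<in> carrier \<AA> \<Longrightarrow> w (amalg_inl (carrier \<AA>) (carrier \<BB>) \<rho> a) = u a"
    "\<And>b. b \<in> carrier \<BB> \<Longrightarrow> w (amalg_inr (carrier \<AA>) (carrier \<BB>) \<rho> b) = v b"
proof -
  let ?A = "carrier \<AA>" and ?B = "carrier \<BB>"
  define \<rho> where "\<rho> = {(a, b) \<in> ?A \<times> ?B. u a = v b}"
  let ?X = "amalg_sum ?A ?B \<rho>"
  \<comment> \<open>The image of a class under the combined map is a singleton, as shown below, and
    \<open>the_elem\<close> extracts its element.\<close>
  define w where "w = (\<lambda>z\<in>?X. the_elem (case_sum u v ` z))"
  let ?C = "pullback_struct w ?X U"
  have \<rho>: "partial_iso \<AA> \<BB> \<rho>" using partial_iso_kernel[OF u v] by (simp add: \<rho>_def)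
  have uv: "u \<in> ?A \<rightarrow> carrier U" "v \<in> ?B \<rightarrow> carrier U" "inj_on u ?A" "inj_on v ?B"
    using u v by (auto simp: embeddings_def)
  \<comment> \<open>\<open>amalg_rel\<close> is the kernel of the combined map: mixed pairs collide
    by the choice of \<rho>, and points of the same side collide only when equal, since
    \<open>u\<close> and \<open>v\<close> are injective.\<close>
  have rel: "(x, y) \<in> amalg_rel ?A ?B \<rho> \<longleftrightarrow> case_sum u v x = case_sum u v y"
    if "x \<in> ?A <+> ?B" "y \<in> ?A <+> ?B" for x y
    using that uv(3,4) by (auto simp: amalg_rel_def \<rho>_def inj_on_eq_iff)
  note eq = equiv_amalg_rel[OF \<rho>]
  have wc: "w (amalg_rel ?A ?B \<rho> `` {x}) = case_sum u v x" if x: "x \<in> ?A <+> ?B" for x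
  proof -
    let ?z = "amalg_rel ?A ?B \<rho> `` {x}"
    have z: "?z \<in> ?X" using x by (simp add: amalg_sum_def quotientI)
    then have "?z \<subseteq> ?A <+> ?B" using in_quotient_imp_subset[OF eq] by (simp add: amalg_sum_def)
    then have "case_sum u v y = case_sum u v x" if "y \<in> ?z" for y
      using rel[OF x subsetD[OF _ that]] that by simp
    then have "case_sum u v ` ?z = {case_sum u v x}" using equiv_class_self[OF eq x] by blast
    then show ?thesis using z by (simp add: w_def)
  qed
  have wi: "w (amalg_inl ?A ?B \<rho> a) = u a" if "a \<in> ?A" for a
    using that wc[OF InlI] by (simp add: amalg_inl_def)
  have wj: "w (amalg_inr ?A ?B \<rho> b) = v b" if "b \<in> ?B" for b
    using that wc[OF InrI] by (simp add: amalg_inr_def)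
  have wX: "w \<in> ?X \<rightarrow>\<^sub>E carrier U"
  proof
    show "w z \<in> carrier U" if "z \<in> ?X" for z
      using that wi wj uv(1,2) by (auto simp: amalg_sum_eq)
  qed (simp add: w_def)
  have inj: "inj_on w ?X"
  proof (rule inj_onI)
    fix y z assume yz: "y \<in> ?X" "z \<in> ?X" "w y = w z"
    obtain x where x: "x \<in> ?A <+> ?B" "y = amalg_rel ?A ?B \<rho> `` {x}"
      using yz(1) unfolding amalg_sum_def by (rule quotientE)
    obtain x' where x': "x' \<in> ?A <+> ?B" "z = amalg_rel ?A ?B \<rho> `` {x'}"
      using yz(2) unfolding amalg_sum_def by (rule quotientE)
    have "(x, x') \<in> amalg_rel ?A ?B \<rho>"
      using yz(3) unfolding rel[OF x(1) x'(1)] x(2) x'(2) wc[OF x(1)] wc[OF x'(1)] .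
    then show "y = z" unfolding x(2) x'(2) by (rule equiv_class_eq[OF eq])
  qed
  have w: "w \<in> embeddings ?C U" using wX inj by (rule embeddings_pullback_struct)
  have "finite ?X" using fin by (simp add: amalg_sum_eq)
  then have "in_class \<Sigma> K ?C" using in_class_pullback_struct[OF U wX inj] by blast
  moreover have "amalg_inl ?A ?B \<rho> \<in> embeddings \<AA> ?C"
    using amalg_inl_extensional[of ?A ?B \<rho>]
    by (intro embeddings_factor[OF w u]) (auto simp: wi amalg_sum_eq PiE_def)
  moreover have "amalg_inr ?A ?B \<rho> \<in> embeddings \<BB> ?C"
    using amalg_inr_extensional[of ?A ?B \<rho>]
    by (intro embeddings_factor[OF w v]) (auto simp: wj amalg_sum_eq PiE_def)
  ultimately have "(\<rho>, ?C) \<in> amalg_index \<Sigma> K \<AA> \<BB>" using \<rho> by (simp add: amalg_index_def)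
  then show thesis using w wi wj by (rule that)
qed

lemma in_class_finite:
  assumes "fraisse_class \<Sigma> K" "in_class \<Sigma> K M"
  shows "finite (carrier M)"
proof -
  obtain N f where "N \<in> K" "f \<in> isos M N" using assms(2) by (auto simp: in_class_def)
  moreover from this have "finite (carrier N)" using assms(1)[unfolded fraisse_class_def, THEN conjunct1] by simp
  ultimately show ?thesis using bij_betw_finite[OF isos_bij_betw] by metis
qed

text \<open>If \<open>w'\<close> is \<open>w\<close> after \<theta>, then \<open>w'\<close> after
  \<open>i\<close> is \<open>w\<close> after \<theta> after \<open>i\<close>, hence \<open>w\<close>
  after \<open>i\<close> after \<sigma>. So restriction along \<open>i\<close> sends a class into a
  single class. A general \<open>i\<close> serves both canonical injections.\<close>

lemma emb_rel_Image_compose: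
  assumes S: "subgroup S (aut_group M)" and P: "subgroup P (aut_group N)"
    and i: "i \<in> embeddings M N" and w: "w \<in> embeddings N U"
    and lift: "\<And>\<theta>. \<theta> \<in> P \<Longrightarrow> \<exists>\<sigma>\<in>S. \<forall>a\<in>carrier M. \<theta> (i a) = i (\<sigma> a)"
  shows "emb_rel U M S `` ((\<lambda>w. compose (carrier M) w i) ` (emb_rel U N P `` {w})) =
    emb_rel U M S `` {compose (carrier M) w i}"
proof (rule equiv_Image_eq_class[OF equiv_emb_rel[OF S]])
  show "compose (carrier M) w i \<in> (\<lambda>w. compose (carrier M) w i) ` (emb_rel U N P `` {w})"
    using equiv_class_self[OF equiv_emb_rel[OF P] w] by (rule imageI)
  have iM: "i a \<in> carrier N" if "a \<in> carrier M" for a using i that by (auto simp: embeddings_def)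
  have "(compose (carrier M) w i, compose (carrier M) w' i) \<in> emb_rel U M S"
    if w': "(w, w') \<in> emb_rel U N P" for w'
  proof -
    obtain \<theta> where "\<theta> \<in> P" and \<theta>: "\<And>z. z \<in> carrier N \<Longrightarrow> w' z = w (\<theta> z)" and "w' \<in> embeddings N U"
      using w' by (auto simp: emb_rel_iff[OF P])
    obtain \<sigma> where \<sigma>: "\<sigma> \<in> S" "\<And>a. a \<in> carrier M \<Longrightarrow> \<theta> (i a) = i (\<sigma> a)"
      using lift[OF \<open>\<theta> \<in> P\<close>] by blast
    have "\<sigma> a \<in> carrier M" if "a \<in> carrier M" for a
      using isos_bij_betw[OF subgroup_aut_group_isos[OF S \<sigma>(1)]] that bij_betwE by blast
    then have "\<forall>a\<in>carrier M. compose (carrier M) w' i a = compose (carrier M) w i (\<sigma> a)"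
      using \<theta> \<sigma>(2) iM by (simp add: compose_eq)
    then show ?thesis
      using \<sigma>(1) compose_embeddings[OF i w] compose_embeddings[OF i \<open>w' \<in> embeddings N U\<close>]
      by (auto simp: emb_rel_iff[OF S])
  qed
  then show "(\<lambda>w. compose (carrier M) w i) ` (emb_rel U N P `` {w}) \<subseteq>
    emb_rel U M S `` {compose (carrier M) w i}" by blast
qed

text \<open>Passing to the opposite group keeps the carrier, so an orbit is swept out by the pairs
  from \<open>S\<close> and \<open>T\<close>.\<close>

lemma mem_orbit_amalg_act_iff:
  "q \<in> orbit (op_group ((aut_group \<AA>)\<lparr>carrier := S\<rparr>) \<times>\<times> (aut_group \<BB>)\<lparr>carrier := T\<rparr>) (amalg_act \<AA> \<BB>) p
    \<longleftrightarrow> (\<exists>\<sigma>\<in>S. \<exists>\<tau>\<in>T. q = amalg_act \<AA> \<BB> (\<sigma>, \<tau>) p)"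
  by (auto simp: orbit_def op_group_def DirProd_def)

section \<open>The equivariant bijection\<close>

theorem theorem10p10:
  fixes \<Sigma> :: "'r signature"
    and K :: "(nat, 'r) rel_struct set"
    and U :: "('d, 'r) rel_struct"
    and \<AA> :: "('a, 'r) rel_struct"
    and \<BB> :: "('b, 'r) rel_struct"
    and S :: "('a \<Rightarrow> 'a) set"
    and T :: "('b \<Rightarrow> 'b) set"
    and R :: "(('a \<times> 'b) set \<times> (('a + 'b) set, 'r) rel_struct) set"
  assumes "finite (dom \<Sigma>)"
    and "fraisse_class \<Sigma> K"
    and "fraisse_limit \<Sigma> K U"
    and "well_behaved U"
    and "in_class \<Sigma> K \<AA>"
    and "in_class \<Sigma> K \<BB>"
    and "subgroup S (aut_group \<AA>)"
    and "subgroup T (aut_group \<BB>)"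
    and "R \<subseteq> amalg_index \<Sigma> K \<AA> \<BB>"
    and "\<forall>orb \<in> orbits (op_group ((aut_group \<AA>)\<lparr>carrier := S\<rparr>) \<times>\<times> (aut_group \<BB>)\<lparr>carrier := T\<rparr>)
                       (amalg_index \<Sigma> K \<AA> \<BB>) (amalg_act \<AA> \<BB>). \<exists>!p. p \<in> R \<and> p \<in> orb"
  shows "\<exists>f. equivariant_bij (aut_group U)
           (emb_quot U \<AA> S \<times> emb_quot U \<BB> T)
           (prod_act (emb_act U \<AA> S) (emb_act U \<BB> T))
           (SIGMA (\<rho>, \<CC>) : R. emb_quot U \<CC> (glued_auts \<AA> \<BB> S T \<rho> \<CC>))
           (coprod_act (\<lambda>(\<rho>, \<CC>). emb_act U \<CC> (glued_auts \<AA> \<BB> S T \<rho> \<CC>)))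
           f"
  proof -
  let ?A = "carrier \<AA>" and ?B = "carrier \<BB>"
  let ?I = "amalg_index \<Sigma> K \<AA> \<BB>"
  let ?P = "glued_auts \<AA> \<BB> S T"
  let ?orb = "orbit (op_group ((aut_group \<AA>)\<lparr>carrier := S\<rparr>) \<times>\<times> (aut_group \<BB>)\<lparr>carrier := T\<rparr>) (amalg_act \<AA> \<BB>)"
  let ?Y = "SIGMA (\<rho>, \<CC>) : R. emb_quot U \<CC> (?P \<rho> \<CC>)"
  let ?\<psi> = "coprod_act (\<lambda>(\<rho>, \<CC>). emb_act U \<CC> (?P \<rho> \<CC>))"
  let ?X = "emb_quot U \<AA> S \<times> emb_quot U \<BB> T"
  let ?\<phi> = "prod_act (emb_act U \<AA> S) (emb_act U \<BB> T)"
  let ?i = "amalg_inl ?A ?B" and ?j = "amalg_inr ?A ?B"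
  note S = assms(7) and T = assms(8)
  have I: "(\<rho>, \<CC>) \<in> ?I" if "(\<rho>, \<CC>) \<in> R" for \<rho> \<CC> using that assms(9) by blast
  have rep: "\<exists>!q. q \<in> R \<and> q \<in> ?orb p" if "p \<in> ?I" for p
    using assms(10) that unfolding orbits_def by blast
  have bS: "bij_betw \<sigma> ?A ?A" if "\<sigma> \<in> S" for \<sigma>
    using isos_bij_betw[OF subgroup_aut_group_isos[OF S that]] .
  have bT: "bij_betw \<tau> ?B ?B" if "\<tau> \<in> T" for \<tau>
    using isos_bij_betw[OF subgroup_aut_group_isos[OF T that]] .
  have P: "subgroup (?P \<rho> \<CC>) (aut_group \<CC>)" if "(\<rho>, \<CC>) \<in> ?I" for \<rho> \<CC>
    using that by (rule subgroup_glued_auts[OF S T])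
  have eqS: "equiv (embeddings \<AA> U) (emb_rel U \<AA> S)" and eqT: "equiv (embeddings \<BB> U) (emb_rel U \<BB> T)"
    using S T by (auto intro: equiv_emb_rel)

  \<comment> \<open>All representatives in \<open>D\<close> are restricted along the injections and
    the result is saturated, so none has to be chosen.\<close>
  define F where "F = (\<lambda>((\<rho>, \<CC> :: (('a + 'b) set, 'r) rel_struct), D).
    (emb_rel U \<AA> S `` ((\<lambda>w. compose ?A w (?i \<rho>)) ` D),
     emb_rel U \<BB> T `` ((\<lambda>w. compose ?B w (?j \<rho>)) ` D)))"
  have F: "F ((\<rho>, \<CC>), emb_rel U \<CC> (?P \<rho> \<CC>) `` {w}) =
      (emb_rel U \<AA> S `` {compose ?A w (?i \<rho>)}, emb_rel U \<BB> T `` {compose ?B w (?j \<rho>)})"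
    if p: "(\<rho>, \<CC>) \<in> ?I" and w: "w \<in> embeddings \<CC> U" for \<rho> \<CC> w
  proof -
    have "\<exists>\<sigma>\<in>S. \<forall>a\<in>?A. \<theta> (?i \<rho> a) = ?i \<rho> (\<sigma> a)" "\<exists>\<tau>\<in>T. \<forall>b\<in>?B. \<theta> (?j \<rho> b) = ?j \<rho> (\<tau> b)"
      if "\<theta> \<in> ?P \<rho> \<CC>" for \<theta>
      using that unfolding mem_glued_auts_iff by blast+
    then show ?thesis
      using emb_rel_Image_compose[OF S P[OF p] amalg_indexD(4)[OF p] w]
        emb_rel_Image_compose[OF T P[OF p] amalg_indexD(5)[OF p] w]
      by (simp add: F_def)
  qed
  have emb: "compose ?A w (?i \<rho>) \<in> embeddings \<AA> U" "compose ?B w (?j \<rho>) \<in> embeddings \<BB> U"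
    if "(\<rho>, \<CC>) \<in> ?I" "w \<in> embeddings \<CC> U" for \<rho> \<CC> w
    using compose_embeddings[OF amalg_indexD(4)[OF that(1)] that(2)]
      compose_embeddings[OF amalg_indexD(5)[OF that(1)] that(2)] by auto

  have maps: "F y \<in> ?X" if "y \<in> ?Y" for y
  proof -
    obtain \<rho> \<CC> D where y: "y = ((\<rho>, \<CC>), D)" "(\<rho>, \<CC>) \<in> R" "D \<in> emb_quot U \<CC> (?P \<rho> \<CC>)"
      using \<open>y \<in> ?Y\<close> by auto
    obtain w where w: "w \<in> embeddings \<CC> U" "D = emb_rel U \<CC> (?P \<rho> \<CC>) `` {w}"
      using y(3) by (rule emb_quot_cases)
    show ?thesis
      unfolding y(1) w(2) F[OF I[OF y(2)] w(1)] using emb[OF I[OF y(2)] w(1)]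
      by (simp add: emb_quot_def quotientI)
  qed

  \<comment> \<open>Injectivity\<close>
  have inj: "inj_on F ?Y"
  proof (rule inj_onI)
    fix x y assume "x \<in> ?Y" "y \<in> ?Y" and Fxy: "F x = F y"
    then obtain \<rho> \<CC> D \<rho>' \<CC>' D' where x: "x = ((\<rho>, \<CC>), D)" and p: "(\<rho>, \<CC>) \<in> R"
      and D: "D \<in> emb_quot U \<CC> (?P \<rho> \<CC>)" and y: "y = ((\<rho>', \<CC>'), D')" and q: "(\<rho>', \<CC>') \<in> R"
      and D': "D' \<in> emb_quot U \<CC>' (?P \<rho>' \<CC>')"
      by auto
    obtain w where w: "w \<in> embeddings \<CC> U" "D = emb_rel U \<CC> (?P \<rho> \<CC>) `` {w}"
      using D by (rule emb_quot_cases)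
    obtain w' where w': "w' \<in> embeddings \<CC>' U" "D' = emb_rel U \<CC>' (?P \<rho>' \<CC>') `` {w'}"
      using D' by (rule emb_quot_cases)
    note pI = I[OF p] and qI = I[OF q]
    have "emb_rel U \<AA> S `` {compose ?A w (?i \<rho>)} = emb_rel U \<AA> S `` {compose ?A w' (?i \<rho>')}"
      "emb_rel U \<BB> T `` {compose ?B w (?j \<rho>)} = emb_rel U \<BB> T `` {compose ?B w' (?j \<rho>')}"
      using Fxy F[OF pI w(1)] F[OF qI w'(1)] by (auto simp: x y w(2) w'(2))
    \<comment> \<open>The second pair is reversed, so that \<sigma> appears on the side of
      \<open>w\<close> and \<tau> on the side of \<open>w'\<close>, as \<open>amalg_act_eq\<close>
      requires.\<close>
    then have "(compose ?A w (?i \<rho>), compose ?A w' (?i \<rho>')) \<in> emb_rel U \<AA> S"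
      "(compose ?B w' (?j \<rho>'), compose ?B w (?j \<rho>)) \<in> emb_rel U \<BB> T"
      using eq_equiv_class[OF _ eqS emb(1)[OF qI w'(1)]] eq_equiv_class[OF sym eqT emb(2)[OF pI w(1)]] by blast+
    then obtain \<sigma> \<tau> where \<sigma>: "\<sigma> \<in> S" "\<And>a. a \<in> ?A \<Longrightarrow> w' (?i \<rho>' a) = w (?i \<rho> (\<sigma> a))"
      and \<tau>: "\<tau> \<in> T" "\<And>b. b \<in> ?B \<Longrightarrow> w' (?j \<rho>' (\<tau> b)) = w (?j \<rho> b)"
      using bij_betwE[OF bS] bij_betwE[OF bT] by (auto simp: emb_rel_iff[OF S] emb_rel_iff[OF T] compose_eq)
    have ends: "?i \<rho>' a \<in> carrier \<CC>'" "?i \<rho> a \<in> carrier \<CC>" if "a \<in> ?A" for a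
      using that by (auto simp: amalg_indexD(3)[OF pI] amalg_indexD(3)[OF qI] amalg_sum_eq)
    have ends': "?j \<rho>' b \<in> carrier \<CC>'" "?j \<rho> b \<in> carrier \<CC>" if "b \<in> ?B" for b
      using that by (auto simp: amalg_indexD(3)[OF pI] amalg_indexD(3)[OF qI] amalg_sum_eq)
    let ?m = "amalg_map ?A ?B \<sigma> \<tau> \<rho>"
    have act: "amalg_act \<AA> \<BB> (\<sigma>, \<tau>) (\<rho>, \<CC>) = (\<rho>', \<CC>')" "?m \<in> isos \<CC> \<CC>'"
      "\<And>z. z \<in> carrier \<CC> \<Longrightarrow> w' (?m z) = w z"
      using \<sigma>(2) \<tau>(2) by (auto intro: amalg_act_eq[OF pI qI bS[OF \<sigma>(1)] bT[OF \<tau>(1)] w(1) w'(1)])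
    have "(\<rho>', \<CC>') \<in> ?orb (\<rho>, \<CC>)"
      unfolding mem_orbit_amalg_act_iff using act(1) \<sigma>(1) \<tau>(1) by metis
    moreover have "(\<rho>, \<CC>) \<in> ?orb (\<rho>, \<CC>)"
    proof -
      note one = subgroup_aut_group_one[OF S] subgroup_aut_group_one[OF T]
      \<comment> \<open>With \<open>w\<close> in both places, the hypotheses of
        \<open>amalg_act_eq\<close> hold trivially for the two identities.\<close>
      have "amalg_act \<AA> \<BB> (\<lambda>a\<in>?A. a, \<lambda>b\<in>?B. b) (\<rho>, \<CC>) = (\<rho>, \<CC>)"
        using amalg_act_eq(1)[OF pI pI bS[OF one(1)] bT[OF one(2)] w(1) w(1)] by simp
      then show ?thesis unfolding mem_orbit_amalg_act_iff using one by metis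
    qed
    \<comment> \<open>Both indices are the representative of one orbit, so they coincide and
      \<open>amalg_map\<close> is an automorphism of \<CC>.\<close>
    ultimately have pq: "\<rho>' = \<rho>" "\<CC>' = \<CC>" using rep[OF pI] p q by auto
    have inj': "z = z'" if "w' z = w' z'" "z \<in> carrier \<CC>'" "z' \<in> carrier \<CC>'" for z z'
      using that w'(1) by (auto simp: embeddings_def inj_on_def)
    have mC: "?m z \<in> carrier \<CC>'" if "z \<in> carrier \<CC>" for z
      using isos_bij_betw[OF act(2)] that bij_betwE by blast
    \<comment> \<open>On left points \<open>amalg_map\<close> acts by the inverse of \<sigma>, so
      the pair witnessing membership in the glued group is \<sigma>' and \<tau>.\<close>
    obtain \<sigma>' where \<sigma>': "\<sigma>' \<in> S" "\<And>a. a \<in> ?A \<Longrightarrow> \<sigma> (\<sigma>' a) = a"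
      using subgroup_aut_group_inverse[OF S \<sigma>(1)] by blast
    have "?m (?i \<rho> a) = ?i \<rho>' (\<sigma>' a)" if a: "a \<in> ?A" for a
    proof -
      have "\<sigma>' a \<in> ?A" using bS[OF \<sigma>'(1)] a bij_betwE by blast
      moreover from this have "w' (?i \<rho>' (\<sigma>' a)) = w (?i \<rho> a)" using \<sigma>(2) \<sigma>'(2)[OF a] by simp
      ultimately show ?thesis
        using act(3)[OF ends(2)[OF a]] mC[OF ends(2)[OF a]] ends(1) by (intro inj') auto
    qed
    moreover have "?m (?j \<rho> b) = ?j \<rho>' (\<tau> b)" if b: "b \<in> ?B" for b
    proof -
      have "\<tau> b \<in> ?B" using bT[OF \<tau>(1)] b bij_betwE by blast
      then show ?thesis
        using \<tau>(2)[OF b] act(3)[OF ends'(2)[OF b]] mC[OF ends'(2)[OF b]] ends'(1) by (intro inj') auto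
    qed
    ultimately have "?m \<in> ?P \<rho> \<CC>"
      unfolding mem_glued_auts_iff using act(2) \<sigma>'(1) \<tau>(1) by (auto simp: pq)
    then have "(w', w) \<in> emb_rel U \<CC> (?P \<rho> \<CC>)"
      using w(1) w'(1) act(3) by (auto simp: emb_rel_iff[OF P[OF pI]] pq intro!: bexI[of _ ?m])
    then have "D' = D" using equiv_class_eq[OF equiv_emb_rel[OF P[OF pI]]] by (simp add: w(2) w'(2) pq)
    then show "x = y" by (simp add: x y pq)
  qed

  \<comment> \<open>Surjectivity\<close>
  have surj: "x \<in> F ` ?Y" if "x \<in> ?X" for x
  proof -
    obtain c d where x: "x = (c, d)" and cd: "c \<in> emb_quot U \<AA> S" "d \<in> emb_quot U \<BB> T"
      using \<open>x \<in> ?X\<close> by auto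
    obtain u where u: "u \<in> embeddings \<AA> U" "c = emb_rel U \<AA> S `` {u}" using cd(1) by (rule emb_quot_cases)
    obtain v where v: "v \<in> embeddings \<BB> U" "d = emb_rel U \<BB> T `` {v}" using cd(2) by (rule emb_quot_cases)
    obtain \<rho> \<CC> w where pI: "(\<rho>, \<CC>) \<in> ?I" and w: "w \<in> embeddings \<CC> U"
      and wi: "\<And>a. a \<in> ?A \<Longrightarrow> w (?i \<rho> a) = u a" and wj: "\<And>b. b \<in> ?B \<Longrightarrow> w (?j \<rho> b) = v b"
      using amalg_index_of_embeddings[OF assms(3) in_class_finite[OF assms(2,5)] in_class_finite[OF assms(2,6)] u(1) v(1)]
      by metis
    \<comment> \<open>The index obtained by gluing need not lie in \<open>R\<close>; its
      representative is reached by some \<sigma> and \<tau>.\<close>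
    obtain \<rho>' \<CC>' \<sigma> \<tau> where q: "(\<rho>', \<CC>') \<in> R" and \<sigma>: "\<sigma> \<in> S" and \<tau>: "\<tau> \<in> T"
      and act: "(\<rho>', \<CC>') = amalg_act \<AA> \<BB> (\<sigma>, \<tau>) (\<rho>, \<CC>)"
      using rep[OF pI] unfolding mem_orbit_amalg_act_iff by (metis surj_pair)
    let ?m = "amalg_map ?A ?B \<sigma> \<tau> \<rho>"
    note pD = amalg_indexD[OF pI] and qI = I[OF q]
    have \<rho>': "\<rho>' = moved_rel ?A ?B \<sigma> \<tau> \<rho>" and \<CC>': "\<CC>' = image_struct ?m \<CC>"
      using act by (auto simp: amalg_act_def)
    note \<rho> = partial_iso_subset[OF pD(1)]
    have "inj_on ?m (carrier \<CC>)" "?m \<in> extensional (carrier \<CC>)"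
      using bij_betw_amalg_map[OF bS[OF \<sigma>] bT[OF \<tau>] \<rho>] pD(3) by (auto simp: bij_betw_def amalg_map_def)
    then have m: "?m \<in> isos \<CC> \<CC>'" using image_struct_unique[OF pD(2)] \<CC>' by blast
    \<comment> \<open>This is \<open>w\<close> carried to the representative along the inverse of
      \<open>amalg_map\<close>.\<close>
    define w' where "w' = compose (carrier \<CC>') w (\<lambda>z\<in>carrier \<CC>'. inv_into (carrier \<CC>) ?m z)"
    have w': "w' \<in> embeddings \<CC>' U"
      unfolding w'_def using inv_isos[OF m] w by (intro compose_embeddings) (auto simp: isos_def)
    have w'm: "w' (?m z) = w z" if "z \<in> carrier \<CC>" for z
      using isos_bij_betw[OF m] that by (auto simp: w'_def compose_def bij_betw_def)
    \<comment> \<open>The left point of a in the new sum comes from the left point of \<sigma> a in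
      the old one. So the left restriction of \<open>w'\<close> is \<open>u\<close> after \<sigma>,
      still in the class \<open>c\<close>.\<close>
    have "w' (?i \<rho>' a) = u (\<sigma> a)" if a: "a \<in> ?A" for a
    proof -
      have \<sigma>a: "\<sigma> a \<in> ?A" using bS[OF \<sigma>] a bij_betwE by blast
      have "inv_into ?A \<sigma> (\<sigma> a) = a" using bS[OF \<sigma>] a by (simp add: bij_betw_def)
      then have "?i \<rho>' a = ?m (?i \<rho> (\<sigma> a))"
        using amalg_map_inl[OF bS[OF \<sigma>] bT[OF \<tau>] \<rho> \<sigma>a] by (simp add: \<rho>')
      then show ?thesis using w'm[of "?i \<rho> (\<sigma> a)"] wi[OF \<sigma>a] \<sigma>a by (simp add: pD(3) amalg_sum_eq)
    qed
    then have "(u, compose ?A w' (?i \<rho>')) \<in> emb_rel U \<AA> S"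
      using u(1) emb(1)[OF qI w'] \<sigma> by (auto simp: emb_rel_iff[OF S] compose_eq)
    then have c: "c = emb_rel U \<AA> S `` {compose ?A w' (?i \<rho>')}"
      unfolding u(2) by (rule equiv_class_eq[OF eqS])
    have "w' (?j \<rho>' (\<tau> b)) = v b" "\<tau> b \<in> ?B" if b: "b \<in> ?B" for b
    proof -
      show "\<tau> b \<in> ?B" using bT[OF \<tau>] b bij_betwE by blast
      have "?j \<rho>' (\<tau> b) = ?m (?j \<rho> b)"
        using amalg_map_inr[OF bS[OF \<sigma>] bT[OF \<tau>] \<rho> b] by (simp add: \<rho>')
      then show "w' (?j \<rho>' (\<tau> b)) = v b" using w'm[of "?j \<rho> b"] wj[OF b] b by (simp add: pD(3) amalg_sum_eq)
    qed
    then have "(compose ?B w' (?j \<rho>'), v) \<in> emb_rel U \<BB> T"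
      using v(1) emb(2)[OF qI w'] \<tau> by (auto simp: emb_rel_iff[OF T] compose_eq intro!: bexI[of _ \<tau>])
    then have d: "d = emb_rel U \<BB> T `` {compose ?B w' (?j \<rho>')}"
      unfolding v(2) by (rule equiv_class_eq[OF eqT, symmetric])
    have "x = F ((\<rho>', \<CC>'), emb_rel U \<CC>' (?P \<rho>' \<CC>') `` {w'})"
      unfolding F[OF qI w'] x c d ..
    moreover have "((\<rho>', \<CC>'), emb_rel U \<CC>' (?P \<rho>' \<CC>') `` {w'}) \<in> ?Y"
      using q w' by (auto simp: emb_quot_def intro: quotientI)
    ultimately show ?thesis by (rule image_eqI)
  qed

  \<comment> \<open>Equivariance\<close>
  have act: "F (?\<psi> \<pi> y) = ?\<phi> \<pi> (F y)" "?\<psi> \<pi> y \<in> ?Y" if \<pi>: "\<pi> \<in> carrier (aut_group U)" and "y \<in> ?Y" for \<pi> y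
  proof -
    obtain \<rho> \<CC> D where y: "y = ((\<rho>, \<CC>), D)" and p: "(\<rho>, \<CC>) \<in> R" and D: "D \<in> emb_quot U \<CC> (?P \<rho> \<CC>)"
      using \<open>y \<in> ?Y\<close> by auto
    obtain w where w: "w \<in> embeddings \<CC> U" "D = emb_rel U \<CC> (?P \<rho> \<CC>) `` {w}"
      using D by (rule emb_quot_cases)
    note pI = I[OF p]
    show "?\<psi> \<pi> y \<in> ?Y" using emb_act_closed[OF P[OF pI] \<pi> D] p by (auto simp: y coprod_act_def)
    have \<pi>w: "compose (carrier \<CC>) \<pi> w \<in> embeddings \<CC> U"
      using compose_embeddings[OF w(1)] \<pi> by (auto simp: isos_def)
    \<comment> \<open>Restriction precomposes and the action postcomposes, so they commute. The two
      bounds in \<open>compose\<close> agree because the injections land in the carrier of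
      \<CC>.\<close>
    have assoc: "compose ?A (compose (carrier \<CC>) \<pi> w) (?i \<rho>) = compose ?A \<pi> (compose ?A w (?i \<rho>))"
      "compose ?B (compose (carrier \<CC>) \<pi> w) (?j \<rho>) = compose ?B \<pi> (compose ?B w (?j \<rho>))"
      by (auto simp: compose_def fun_eq_iff amalg_indexD(3)[OF pI] amalg_sum_eq)
    show "F (?\<psi> \<pi> y) = ?\<phi> \<pi> (F y)"
      using F[OF pI w(1)] F[OF pI \<pi>w] emb_act_class[OF \<pi> w(1) P[OF pI]]
        emb_act_class[OF \<pi> emb(1)[OF pI w(1)] S] emb_act_class[OF \<pi> emb(2)[OF pI w(1)] T]
      by (simp add: y w(2) coprod_act_def prod_act_def assoc)
  qed
  have "bij_betw F ?Y ?X"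
    using inj maps surj by (intro bij_betw_imageI) blast+
  then have eqv: "equivariant_bij (aut_group U) ?Y ?\<psi> ?X ?\<phi> F"
    using act(1) unfolding equivariant_bij_def by blast
  show ?thesis
  proof (rule exI, rule equivariant_bij_inv_into[OF eqv])
    show "?\<psi> \<pi> y \<in> ?Y" if "\<pi> \<in> carrier (aut_group U)" "y \<in> ?Y" for \<pi> y
      using that by (rule act(2))
  qed
qed

end
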